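(* Let $\mathbf{M}=\begin{pmatrix}a&b\\c&d\end{pmatrix}\in SL(2,\mathbb{Z})$ with $b>0$, let $q,p\in\mathbb{Z}$ satisfy $(q,p)\equiv(ab,cd)\pmod 2$, and let $\mu(\mathbf{M};(q,p))$ be the nonzero complex number for which $\mathcal{S}_{(\frac q2,\frac p2)}\mathcal{M}(\mathbf{M})Ш_1=\mu(\mathbf{M};(q,p))\,Ш_1$. Then, with $$E(n) = -\frac{d}{2b}\left(n-\frac q2\right)^2-\frac12pn+\frac18qp,$$ one has $$\mu(\mathbf{M};(q,p)) = \frac{e^{-\frac{\pi \mathrm{i}}{4}}}{\sqrt b}\sum_{n=0}^{b-1}e^{-2\pi \mathrm{i}E(n)}.$$
   Context: $Ш_1=\sum_{k\in\mathbb{Z}}\delta(x-k)\in\mathscr{S}'(\mathbb{R})$ is the Dirac comb. Phase-space shift: $\mathcal{S}_{(x_0,\xi_0)}f(x)=e^{-\pi \mathrm{i}x_0\xi_0+2\pi \mathrm{i}\xi_0x}f(x-x_0)$ for $(x_0,\xi_0)\in\mathbb{R}^2$. Metaplectic operator: for $\mathbf{M}=\begin{pmatrix}a&b\\c&d\end{pmatrix}\in SL(2,\mathbb{R})$ with $b\ne0$, $$\mathcal{M}(\mathbf{M})f(x)=\frac1{\sqrt{\mathrm{i}b}}\int_{\mathbb{R}}e^{\frac{\pi \mathrm{i}}{b}(dx^2-2xy+ay^2)}f(y)\,dy,\qquad \operatorname{Re}\sqrt{\mathrm{i}b}>0.$$ It is an automorphism of $\mathscr{S}(\mathbb{R})$,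 extended to $\mathscr{S}'(\mathbb{R})$. For $\mathbf{M}\in SL(2,\mathbb{Z})$ and $(q,p)\equiv(ab,cd)\pmod2$, $Ш_1$ is an eigenvector of $\mathcal{S}_{(\frac q2,\frac p2)}\mathcal{M}(\mathbf{M})$ with nonzero eigenvalue, so $\mu(\mathbf{M};(q,p))$ is well defined. *)

theory Defs
  imports "HOL-Probability.Sinc_Integral" "HOL-Number_Theory.Cong"
begin

definition vderiv :: "(real \<Rightarrow> complex) \<Rightarrow> real \<Rightarrow> complex" where
  "vderiv f = (\<lambda>x. vector_derivative f (at x))"

definition schwartz :: "(real \<Rightarrow> complex) set" where
  "schwartz = {f. \<forall>n. (\<forall>x. (vderiv ^^ n) f differentiable at x) \<and>
                      (\<forall>k. bounded (range (\<lambda>x. x ^ k *\<^sub>R (vderiv ^^ n) f x)))}"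

definition schwartz_seminorm :: "nat \<Rightarrow> nat \<Rightarrow> (real \<Rightarrow> complex) \<Rightarrow> real" where
  "schwartz_seminorm k n f = (SUP x. norm (x ^ k *\<^sub>R (vderiv ^^ n) f x))"

(* Distributions are functionals on all functions, but only their values on the set schwartz are
   meaningful: two of them are the same element of S'(R) if they agree on schwartz. *)
type_synonym functional = "(real \<Rightarrow> complex) \<Rightarrow> complex"

definition tempered_distribution :: "functional \<Rightarrow> bool" where
  "tempered_distribution u \<longleftrightarrow>
     (\<forall>f\<in>schwartz. \<forall>g\<in>schwartz. u (\<lambda>x. f x + g x) = u f + u g) \<and>
     (\<forall>f\<in>schwartz. \<forall>\<alpha>. u (\<lambda>x. \<alpha> * f x) = \<alpha> * u f) \<and>
     (\<exists>C N. \<forall>f\<in>schwartz. norm (u f) \<le> C * (\<Sum>k\<le>N. \<Sum>n\<le>N. schwartz_seminorm k n f))"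

definition distribution_of :: "(real \<Rightarrow> complex) \<Rightarrow> functional" where
  "distribution_of f \<phi> = (LINT x|lborel. f x * \<phi> x)"

definition dirac_comb :: functional where
  "dirac_comb \<phi> = (\<Sum>\<^sub>\<infinity>k::int. \<phi> (of_int k))"

definition phase_shift :: "real \<Rightarrow> real \<Rightarrow> (real \<Rightarrow> complex) \<Rightarrow> real \<Rightarrow> complex" where
  "phase_shift x0 \<xi>0 f x =
     exp (- of_real pi * \<i> * of_real x0 * of_real \<xi>0 + 2 * of_real pi * \<i> * of_real \<xi>0 * of_real x)
       * f (x - x0)"

(* The extension to S'(R) is by transposition with respect to the bilinear pairing of
   distribution_of; phase_shift (- x0) \<xi>0 is the transpose of phase_shift x0 \<xi>0, and
   metaplectic_transpose below that of metaplectic.  The lemmas *_dist_distribution_of in the rest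
   of this theory show that this extends the operators on functions. *)
definition phase_shift_dist :: "real \<Rightarrow> real \<Rightarrow> functional \<Rightarrow> functional" where
  "phase_shift_dist x0 \<xi>0 u \<phi> = u (phase_shift (- x0) \<xi>0 \<phi>)"

(* Only used for matrices whose upper right entry b is nonzero.  As csqrt is the principal branch,
   Re (csqrt (\<i> * b)) > 0 for real b \<noteq> 0. *)
definition metaplectic_kernel :: "real^2^2 \<Rightarrow> real \<Rightarrow> real \<Rightarrow> complex" where
  "metaplectic_kernel M x y =
     (let a = M $ 1 $ 1; b = M $ 1 $ 2; d = M $ 2 $ 2
      in 1 / csqrt (\<i> * of_real b) *
         exp (of_real pi * \<i> / of_real b * of_real (d * x\<^sup>2 - 2 * x * y + a * y\<^sup>2)))"

definition metaplectic :: "real^2^2 \<Rightarrow> (real \<Rightarrow> complex) \<Rightarrow> real \<Rightarrow> complex" where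
  "metaplectic M f x = (LINT y|lborel. metaplectic_kernel M x y * f y)"

definition metaplectic_transpose :: "real^2^2 \<Rightarrow> (real \<Rightarrow> complex) \<Rightarrow> real \<Rightarrow> complex" where
  "metaplectic_transpose M \<phi> y = (LINT x|lborel. metaplectic_kernel M x y * \<phi> x)"

definition metaplectic_dist :: "real^2^2 \<Rightarrow> functional \<Rightarrow> functional" where
  "metaplectic_dist M u \<phi> = u (metaplectic_transpose M \<phi>)"

definition real_matrix :: "int^2^2 \<Rightarrow> real^2^2" where
  "real_matrix M = (\<chi> i j. of_int (M $ i $ j))"

(* The number mu(M;(q,p)). *)
definition comb_eigenvalue :: "int^2^2 \<Rightarrow> int \<Rightarrow> int \<Rightarrow> complex" where
  "comb_eigenvalue M q p = (THE \<mu>. \<mu> \<noteq> 0 \<and>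
     (\<forall>\<phi>\<in>schwartz. phase_shift_dist (of_int q / 2) (of_int p / 2)
                      (metaplectic_dist (real_matrix M) dirac_comb) \<phi> = \<mu> * dirac_comb \<phi>))"


lemma schwartz_continuous: "f \<in> schwartz \<Longrightarrow> continuous_on UNIV f"
proof -
  assume "f \<in> schwartz"
  then have "\<forall>x. (vderiv ^^ 0) f differentiable at x" unfolding schwartz_def by blast
  then show ?thesis
    by (auto intro!: continuous_at_imp_continuous_on differentiable_imp_continuous_within)
qed

lemma schwartz_seminorm_upper:
  assumes "f \<in> schwartz"
  shows "norm (x ^ k *\<^sub>R (vderiv ^^ n) f x) \<le> schwartz_seminorm k n f"
proof -
  have "bounded (range (\<lambda>x. x ^ k *\<^sub>R (vderiv ^^ n) f x))"
    using assms unfolding schwartz_def by blast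
  then have "bdd_above (range (\<lambda>x. norm (x ^ k *\<^sub>R (vderiv ^^ n) f x)))"
    by (auto simp: bounded_iff bdd_above_def)
  then show ?thesis unfolding schwartz_seminorm_def by (rule cSUP_upper[rotated]) simp
qed

lemma schwartz_decay:
  assumes "f \<in> schwartz"
  shows "norm (f x) \<le> (schwartz_seminorm 0 0 f + schwartz_seminorm 2 0 f) * inverse (1 + x\<^sup>2)"
proof -
  have "(1 + x\<^sup>2) * norm (f x) \<le> schwartz_seminorm 0 0 f + schwartz_seminorm 2 0 f"
    using schwartz_seminorm_upper[OF assms, of x 0 0] schwartz_seminorm_upper[OF assms, of x 2 0]
    by (simp add: algebra_simps)
  moreover have "1 + x\<^sup>2 > 0" by (simp add: add_pos_nonneg)
  ultimately show ?thesis by (simp add: field_simps)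
qed

lemma lborel_integrable_inverse_1_plus_square: "integrable lborel (\<lambda>x::real. inverse (1 + x\<^sup>2))"
proof -
  have pos: "set_integrable lborel {0<..} (\<lambda>x::real. inverse (1 + x\<^sup>2))"
    using integrable_I0i_1_div_plus_square
    by (simp add: interval_lebesgue_integrable_def einterval_eq zero_ereal_def inverse_eq_divide)
  have "integrable lborel (\<lambda>x::real. indicator {0<..} (0 + (-1) * x) *\<^sub>R inverse (1 + (0 + (-1) * x)\<^sup>2))"
    using pos unfolding set_integrable_def by (rule lborel_integrable_real_affine) simp
  then have "integrable lborel (\<lambda>x::real. indicator {0<..} x *\<^sub>R inverse (1 + x\<^sup>2)
      + indicator {0<..} (-x) *\<^sub>R inverse (1 + x\<^sup>2))"
    using pos unfolding set_integrable_def by simp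
  then show ?thesis
  proof (rule integrable_cong_AE_imp)
    show "AE x::real in lborel. indicator {0<..} x *\<^sub>R inverse (1 + x\<^sup>2)
      + indicator {0<..} (-x) *\<^sub>R inverse (1 + x\<^sup>2) = inverse (1 + x\<^sup>2)"
      using AE_lborel_singleton[of 0] by eventually_elim (auto simp: indicator_def)
  qed simp
qed

lemma schwartz_integrable: "f \<in> schwartz \<Longrightarrow> integrable lborel f"
proof -
  assume f: "f \<in> schwartz"
  have "f \<in> borel_measurable lborel"
    using schwartz_continuous[OF f] borel_measurable_continuous_onI by simp
  then show ?thesis
    by (rule Bochner_Integration.integrable_bound[OF integrable_mult_right[OF
          lborel_integrable_inverse_1_plus_square, of "schwartz_seminorm 0 0 f + schwartz_seminorm 2 0 f"]])
      (use schwartz_decay[OF f] in \<open>auto intro: order_trans[OF _ abs_ge_self]\<close>)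
qed

lemma phase_shift_dist_distribution_of:
  "phase_shift_dist x0 \<xi>0 (distribution_of f) \<phi> = distribution_of (phase_shift x0 \<xi>0 f) \<phi>"
proof -
  have "distribution_of (phase_shift x0 \<xi>0 f) \<phi> =
      (LINT y|lborel. phase_shift x0 \<xi>0 f (x0 + 1 * y) * \<phi> (x0 + 1 * y))"
    unfolding distribution_of_def by (subst lborel_integral_real_affine[of 1 _ x0]) simp_all
  also have "\<dots> = (LINT y|lborel. f y * phase_shift (- x0) \<xi>0 \<phi> y)"
  proof (rule Bochner_Integration.integral_cong, simp)
    fix y :: real
    have "exp (- of_real pi * \<i> * of_real x0 * of_real \<xi>0
            + 2 * of_real pi * \<i> * of_real \<xi>0 * of_real (x0 + y)) =
          exp (- of_real pi * \<i> * of_real (- x0) * of_real \<xi>0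
            + 2 * of_real pi * \<i> * of_real \<xi>0 * of_real y)"
      by (rule arg_cong[where f = exp]) (simp add: algebra_simps)
    then show "phase_shift x0 \<xi>0 f (x0 + 1 * y) * \<phi> (x0 + 1 * y) = f y * phase_shift (- x0) \<xi>0 \<phi> y"
      unfolding phase_shift_def by (simp add: add.commute)
  qed
  finally show ?thesis unfolding phase_shift_dist_def distribution_of_def by simp
qed

lemma metaplectic_dist_distribution_of:
  assumes f: "f \<in> schwartz" and \<phi>: "\<phi> \<in> schwartz"
  shows "metaplectic_dist M (distribution_of f) \<phi> = distribution_of (metaplectic M f) \<phi>"
proof -
  let ?K = "metaplectic_kernel M"
  have [measurable]: "f \<in> borel_measurable borel" "\<phi> \<in> borel_measurable borel"
    using f \<phi> schwartz_continuous borel_measurable_continuous_onI by blast+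
  have [measurable]: "(\<lambda>(x, y). ?K x y) \<in> borel_measurable (borel \<Otimes>\<^sub>M borel)"
  proof -
    have "continuous_on UNIV (\<lambda>z. ?K (fst z) (snd z))"
      unfolding metaplectic_kernel_def Let_def divide_inverse by (intro continuous_intros)
    then show ?thesis
      unfolding borel_prod case_prod_beta by (rule borel_measurable_continuous_onI)
  qed
  have K: "norm (?K x y) = norm (1 / csqrt (\<i> * of_real (M $ 1 $ 2)))" for x y
    by (simp add: metaplectic_kernel_def Let_def norm_mult norm_divide)
  have "integrable (lborel \<Otimes>\<^sub>M lborel) (\<lambda>(x, y). ?K x y * f y * \<phi> x)"
  proof (rule Bochner_Integration.integrable_bound)
    show "integrable (lborel \<Otimes>\<^sub>M lborel) (\<lambda>(x, y). (norm (1 / csqrt (\<i> * of_real (M $ 1 $ 2))) * \<phi> x) * f y)"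
      using schwartz_integrable[OF f] schwartz_integrable[OF \<phi>]
      by (intro lborel_pair.Fubini_integrable)
         (auto simp: norm_mult integral_mult_right_zero)
    show "AE z in lborel \<Otimes>\<^sub>M lborel. norm (case z of (x, y) \<Rightarrow> ?K x y * f y * \<phi> x) \<le>
        norm (case z of (x, y) \<Rightarrow> (norm (1 / csqrt (\<i> * of_real (M $ 1 $ 2))) * \<phi> x) * f y)"
      by (auto simp: norm_mult K)
  qed measurable
  from lborel_pair.Fubini_integral[OF this]
  have swap: "(LINT y|lborel. LINT x|lborel. ?K x y * f y * \<phi> x) =
        (LINT x|lborel. LINT y|lborel. ?K x y * f y * \<phi> x)" .
  have y: "(LINT x|lborel. ?K x y * f y * \<phi> x) = f y * metaplectic_transpose M \<phi> y" for y
    unfolding metaplectic_transpose_def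
    by (subst integral_mult_right_zero[symmetric]) (simp add: mult_ac)
  have x: "(LINT y|lborel. ?K x y * f y * \<phi> x) = metaplectic M f x * \<phi> x" for x
    unfolding metaplectic_def by (subst integral_mult_left_zero[symmetric]) (simp add: mult_ac)
  show ?thesis
    using swap unfolding metaplectic_dist_def distribution_of_def x y .
qed

lemma summable_on_int_inverse_1_plus_square:
  "(\<lambda>k::int. inverse (1 + (of_int k)\<^sup>2) :: real) summable_on UNIV"
proof -
  let ?g = "\<lambda>k::int. inverse (1 + (of_int k)\<^sup>2) :: real"
  have "summable (\<lambda>n. inverse (1 + (real n)\<^sup>2))"
  proof (rule summable_comparison_test')
    show "summable (\<lambda>n. inverse ((real n)\<^sup>2))"
      using inverse_power_summable[of 2, where 'a = real] by (simp add: power_inverse)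
    show "norm (inverse (1 + (real n)\<^sup>2)) \<le> inverse ((real n)\<^sup>2)" if "n \<ge> 1" for n
      using that by (simp add: le_imp_inverse_le)
  qed
  then have *: "(\<lambda>n. inverse (1 + (real n)\<^sup>2)) summable_on UNIV"
    by (subst summable_on_UNIV_nonneg_real_iff) auto
  have "?g summable_on range int"
    by (subst summable_on_reindex) (use * in \<open>auto simp: o_def\<close>)
  moreover have "?g summable_on range (\<lambda>n. - int n)"
    by (subst summable_on_reindex) (use * in \<open>auto simp: o_def inj_on_def\<close>)
  ultimately have "?g summable_on (range int \<union> range (\<lambda>n. - int n))"
    by (rule summable_on_union)
  moreover have "range int \<union> range (\<lambda>n. - int n) = UNIV"
    by (auto simp: image_iff) (metis int_cases2)
  ultimately show ?thesis by simp
qed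

lemma schwartz_abs_summable_int:
  assumes "f \<in> schwartz"
  shows "(\<lambda>k::int. norm (f (of_int k))) summable_on UNIV"
  by (rule summable_on_comparison_test[OF summable_on_cmult_right[OF
        summable_on_int_inverse_1_plus_square,
        of "schwartz_seminorm 0 0 f + schwartz_seminorm 2 0 f"]])
     (use schwartz_decay[OF assms] in auto)

lemma tempered_distribution_dirac_comb: "tempered_distribution dirac_comb"
  unfolding tempered_distribution_def
proof (intro conjI ballI allI)
  fix f g assume fg: "f \<in> schwartz" "g \<in> schwartz"
  show "dirac_comb (\<lambda>x. f x + g x) = dirac_comb f + dirac_comb g"
    unfolding dirac_comb_def
    by (rule infsum_add) (rule abs_summable_summable, rule schwartz_abs_summable_int, rule fg)+
next
  fix f \<alpha> show "dirac_comb (\<lambda>x. \<alpha> * f x) = \<alpha> * dirac_comb f"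
    unfolding dirac_comb_def by (rule infsum_cmult_right')
next
  define C where "C = (\<Sum>\<^sub>\<infinity>k::int. inverse (1 + (of_int k)\<^sup>2) :: real)"
  have "C \<ge> 0" unfolding C_def by (intro infsum_nonneg) auto
  have "norm (dirac_comb f) \<le> C * (\<Sum>k\<le>2. \<Sum>n\<le>2. schwartz_seminorm k n f)"
    if f: "f \<in> schwartz" for f
  proof -
    have nn: "schwartz_seminorm k n f \<ge> 0" for k n
      using schwartz_seminorm_upper[OF f, of 0 k n] norm_ge_zero order_trans by blast
    have "norm (dirac_comb f) \<le> (\<Sum>\<^sub>\<infinity>k::int. norm (f (of_int k)))"
      unfolding dirac_comb_def by (rule norm_infsum_bound[OF schwartz_abs_summable_int[OF f]])
    also have "\<dots> \<le> (\<Sum>\<^sub>\<infinity>k::int. (schwartz_seminorm 0 0 f + schwartz_seminorm 2 0 f) *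
                     inverse (1 + (of_int k)\<^sup>2))"
      using schwartz_decay[OF f]
      by (intro infsum_mono schwartz_abs_summable_int f summable_on_cmult_right
            summable_on_int_inverse_1_plus_square)
    also have "\<dots> = C * (schwartz_seminorm 0 0 f + schwartz_seminorm 2 0 f)"
      unfolding C_def by (subst infsum_cmult_right') (rule mult.commute)
    also have "\<dots> \<le> C * (\<Sum>k\<le>2. \<Sum>n\<le>2. schwartz_seminorm k n f)"
      using nn by (intro mult_left_mono \<open>C \<ge> 0\<close>) (simp add: numeral_2_eq_2)
    finally show ?thesis .
  qed
  then show "\<exists>C N. \<forall>f\<in>schwartz. norm (dirac_comb f) \<le> C * (\<Sum>k\<le>N. \<Sum>n\<le>N. schwartz_seminorm k n f)"
    by blast
qed

end

theory Submission
  imports Defs "HOL-Real_Asymp.Real_Asymp" "HOL-Computational_Algebra.Polynomial"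
begin

text \<open>
Transposing both operators onto a Schwartz function \<open>\<phi>\<close> turns the eigenvector equation into an
identity between sums over the integers. After the substitution \<open>x = t - q/2\<close>, the value at an
integer \<open>k\<close> of the transposed function is, up to a factor independent of \<open>k\<close>,
\<open>e(a k\<^sup>2 + q k)\<close> times the Fourier transform at \<open>k / b\<close> of a quadratic chirp times \<open>\<phi>\<close>, where
\<open>e(m) = exp (\<pi> i m / b)\<close>. The congruence \<open>q \<equiv> ab\<close> makes \<open>k \<mapsto> e(a k\<^sup>2 + q k)\<close> periodic
modulo \<open>b\<close>, so the sum over \<open>k\<close> splits into residue classes \<open>k = b j + r\<close>, and on each of them the
Poisson summation formula replaces the sum over \<open>j\<close> by a sum over integer points. The
coefficient of \<open>\<phi>(n)\<close> in the result is, up to a nonzero constant,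
\<open>\<Sum>\<^sub>r e(a r\<^sup>2 + q r) e(d n\<^sup>2 - d q n + b p n - 2 r n)\<close>. Completing the square with \<open>ad \<equiv> 1\<close>
modulo \<open>b\<close>, that is, translating \<open>r\<close> by \<open>d n\<close>, and using \<open>p \<equiv> cd\<close>, shows that this does not
depend on \<open>n\<close> (\<open>gauss_sum_translate\<close>): the comb is an eigenvector (\<open>comb_eigenvector\<close>). The
eigenvalue appears as a Gauss sum with leading coefficient \<open>a\<close>; the substitution \<open>r = - d n\<close>
turns it into the one with leading coefficient \<open>d\<close> and the exponents \<open>E n\<close>
(\<open>gauss_sum_reciprocal\<close>).

As \<open>comb_eigenvalue\<close> is a definite description, two more facts are needed. The Gauss sum is
nonzero, because otherwise all the sums displayed above would vanish, and these are, up to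
nonzero factors, the discrete Fourier transform of a function with values on the unit circle
(\<open>gauss_sum_nonzero\<close>). The eigenvalue is unique, because the comb does not annihilate the
Gaussian.

Poisson summation is proved through the Euler-Maclaurin formula. Two integrations by parts
express the Fourier transform of \<open>g\<close> at \<open>k \<noteq> 0\<close> by that of \<open>g''\<close> divided by
\<open>- (2 \<pi> k)\<^sup>2\<close>. Summed over \<open>k\<close>, the exponentials assemble to the Fourier series
\<open>\<Sum>\<^sub>k cos (2 \<pi> k x) / (\<pi> k)\<^sup>2\<close> of the periodic Bernoulli function \<open>B\<^sub>2\<close>, and the integral of
\<open>- g'' B\<^sub>2 / 2\<close> is the difference between \<open>\<Sum>\<^sub>n g(n)\<close> and the integral of \<open>g\<close>.
\<close>

section \<open>The Fourier series of the second Bernoulli polynomial\<close>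

lemma dirichlet_kernel:
  fixes x :: real
  shows "sin (pi * x) * (1 + 2 * (\<Sum>k=1..N. cos (2 * pi * real k * x))) = sin ((2 * real N + 1) * pi * x)"
proof (induction N)
  case 0
  then show ?case by simp
next
  case (Suc N)
  have "2 * (sin (pi * x) * cos (2 * pi * real (Suc N) * x))
      = sin (pi * x + 2 * pi * real (Suc N) * x) + sin (pi * x - 2 * pi * real (Suc N) * x)"
    by (simp only: sin_add sin_diff)
  also have "pi * x + 2 * pi * real (Suc N) * x = (2 * real (Suc N) + 1) * pi * x"
    by (simp add: algebra_simps)
  also have "pi * x - 2 * pi * real (Suc N) * x = - ((2 * real N + 1) * pi * x)"
    by (simp add: algebra_simps)
  finally have "2 * (sin (pi * x) * cos (2 * pi * real (Suc N) * x))
      = sin ((2 * real (Suc N) + 1) * pi * x) - sin ((2 * real N + 1) * pi * x)"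
    by simp
  moreover have "sin (pi * x) * (1 + 2 * (\<Sum>k=1..Suc N. cos (2 * pi * real k * x)))
     = sin (pi * x) * (1 + 2 * (\<Sum>k=1..N. cos (2 * pi * real k * x)))
       + 2 * (sin (pi * x) * cos (2 * pi * real (Suc N) * x))"
    by (simp add: distrib_left algebra_simps)
  ultimately show ?case using Suc by linarith
qed

text \<open>
The derivative of the partial sum is the Dirichlet kernel \<open>sin ((2N + 1) \<pi> x) / sin (\<pi> x)\<close>,
and one integration by parts extracts \<open>- cos ((2N + 1) \<pi> x) / ((2N + 1) \<pi> sin (\<pi> x))\<close> from its
integral. What remains has a derivative of order \<open>1 / (2N + 1)\<close> away from the integers and vanishes
at \<open>1/2\<close>.
\<close>

lemma sawtooth_partial_sum_bound:
  fixes x \<delta> :: real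
  assumes \<delta>: "0 < \<delta>" and x: "x \<in> {\<delta>..1 - \<delta>}"
  shows "\<bar>x - 1 / 2 + (\<Sum>k=1..N. sin (2 * pi * real k * x) / (pi * real k))\<bar>
           \<le> 2 / ((2 * real N + 1) * (sin (pi * \<delta>))\<^sup>2)"
proof -
  define s where "s = sin (pi * \<delta>)"
  have \<delta>2: "\<delta> \<le> 1 / 2" using x by simp
  have s0: "0 < s" unfolding s_def using \<delta> \<delta>2 by (intro sin_gt_zero) (auto simp: field_simps)
  have s1: "s \<le> 1" unfolding s_def by simp
  have sin_ge: "s \<le> sin (pi * t)" if t: "t \<in> {\<delta>..1 - \<delta>}" for t
  proof (cases "t \<le> 1 / 2")
    case True
    then show ?thesis unfolding s_def using t \<delta> by (intro sin_monotone_2pi_le) (auto intro: order_trans[of _ 0])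
  next
    case False
    have "sin (pi * \<delta>) \<le> sin (pi * (1 - t))"
      using t False \<delta> by (intro sin_monotone_2pi_le mult_left_mono) (auto simp: field_simps intro: order_trans[of _ 0])
    also have "\<dots> = sin (pi * t)" by (simp add: right_diff_distrib)
    finally show ?thesis unfolding s_def .
  qed
  let ?m = "2 * real N + 1"
  \<comment> \<open>The partial sum minus the boundary term of the integration by parts.\<close>
  define U where "U = (\<lambda>t. t - 1 / 2 + (\<Sum>k=1..N. sin (2 * pi * real k * t) / (pi * real k))
                            + cos (?m * pi * t) / (?m * pi * sin (pi * t)))"
  define U' where "U' = (\<lambda>t. - (cos (?m * pi * t) * cos (pi * t)) / (?m * (sin (pi * t))\<^sup>2))"
  have m0: "0 < ?m" by linarith
  have deriv: "(U has_field_derivative U' t) (at t within {\<delta>..1 - \<delta>})" if t: "t \<in> {\<delta>..1 - \<delta>}" for t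
  proof -
    have st: "sin (pi * t) > 0" using sin_ge[OF t] s0 by linarith
    have quotient: "((\<lambda>t. cos (m * pi * t) / (m * pi * sin (pi * t))) has_field_derivative
        (- (sin (m * pi * t) * (m * pi)) * (m * pi * sin (pi * t))
              - cos (m * pi * t) * (m * pi * (cos (pi * t) * pi)))
            / (m * pi * sin (pi * t) * (m * pi * sin (pi * t)))) (at t within {\<delta>..1 - \<delta>})"
      if "m \<noteq> 0" for m
      using st that by (auto intro!: derivative_eq_intros)
    have "((\<lambda>t. t - 1 / 2 + (\<Sum>k=1..N. sin (2 * pi * real k * t) / (pi * real k))) has_field_derivative
        1 + (\<Sum>k=1..N. 2 * cos (2 * pi * real k * t))) (at t within {\<delta>..1 - \<delta>})"
      by (auto intro!: derivative_eq_intros sum.cong)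
    note DERIV_add[OF this quotient[of ?m]]
    moreover have "(1 + (\<Sum>k=1..N. 2 * cos (2 * pi * real k * t))) = sin (?m * pi * t) / sin (pi * t)"
      using dirichlet_kernel[of t N] st by (simp add: field_simps sum_distrib_left)
    moreover have "S / u + (- (S * (m * pi)) * (m * pi * u) - C * (m * pi * (c * pi))) / (m * pi * u * (m * pi * u))
        = - (C * c) / (m * u\<^sup>2)" if "u \<noteq> 0" "m \<noteq> 0" for S C c u m :: real
      using that by (simp add: field_simps power2_eq_square)
    ultimately show ?thesis using st m0 unfolding U_def U'_def by simp
  qed
  have bound: "norm (U' t) \<le> 1 / (?m * s\<^sup>2)" if t: "t \<in> {\<delta>..1 - \<delta>}" for t
  proof -
    have "\<bar>cos (?m * pi * t) * cos (pi * t)\<bar> \<le> 1 * 1"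
      unfolding abs_mult by (intro mult_mono) auto
    moreover have "s\<^sup>2 \<le> (sin (pi * t))\<^sup>2" using sin_ge[OF t] s0 by (intro power_mono) auto
    ultimately show ?thesis unfolding U'_def using m0 s0
      by (auto simp: abs_mult intro!: frac_le mult_left_mono mult_pos_pos)
  qed
  have "cos (?m * pi * (1 / 2)) = 0"
    by (simp add: cos_zero_iff_int) (rule exI[of _ "2 * int N + 1"], simp)
  moreover have "sin (2 * pi * real k * (1/2)) = 0" for k
    by (simp add: mult.commute)
  ultimately have "U (1 / 2) = 0" unfolding U_def by simp
  moreover have "norm (U x - U (1 / 2)) \<le> 1 / (?m * s\<^sup>2) * norm (x - 1 / 2)"
    by (rule field_differentiable_bound[of "{\<delta>..1 - \<delta>}", OF _ deriv bound]) (use x \<delta>2 in auto)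
  moreover have "1 / (?m * s\<^sup>2) * norm (x - 1 / 2) \<le> 1 / (?m * s\<^sup>2) * 1"
    using x \<delta> m0 by (intro mult_left_mono) auto
  ultimately have "\<bar>U x\<bar> \<le> 1 / (?m * s\<^sup>2)" by simp
  moreover have "\<bar>cos (?m * pi * x) / (?m * pi * sin (pi * x))\<bar> \<le> 1 / (?m * s\<^sup>2)"
  proof -
    have "s\<^sup>2 \<le> pi * sin (pi * x)"
    proof -
      have "s * s \<le> 1 * sin (pi * x)" using s0 s1 sin_ge[OF x] by (intro mult_mono) auto
      also have "\<dots> \<le> pi * sin (pi * x)" using sin_ge[OF x] s0 pi_gt3 by (intro mult_right_mono) auto
      finally show ?thesis by (simp add: power2_eq_square)
    qed
    then have "?m * s\<^sup>2 \<le> \<bar>?m * pi * sin (pi * x)\<bar>"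
      using m0 by (subst abs_of_pos) (use sin_ge[OF x] s0 in \<open>auto intro!: mult_pos_pos simp: mult.assoc\<close>)
    then show ?thesis unfolding abs_divide using m0 s0 by (intro frac_le) auto
  qed
  ultimately show ?thesis unfolding U_def s_def[symmetric] by (simp add: abs_if split: if_splits) 
qed

text \<open>
The cosine series converges uniformly, and the derivatives of its partial sums approach that of
\<open>\<pi>\<^sup>2 (x\<^sup>2 - x)\<close> uniformly away from the end points. Hence the difference of the two is constant
inside the interval and, being continuous, on all of it. The value at \<open>0\<close> is the Basel sum
\<open>\<pi>\<^sup>2 / 6\<close>.
\<close>

lemma bernoulli2_cosine_series:
  fixes x :: real
  assumes "x \<in> {0..1}"
  shows "(\<lambda>k. cos (2 * pi * real (Suc k) * x) / (real (Suc k))\<^sup>2) sums (pi\<^sup>2 * (x\<^sup>2 - x + 1 / 6))"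
proof -
  define f where "f = (\<lambda>(k::nat) (x::real). cos (2 * pi * real (Suc k) * x) / (real (Suc k))\<^sup>2)"
  define V where "V = (\<lambda>N x. \<Sum>k<N. f k x)"
  define S where "S = (\<lambda>x. \<Sum>k. f k x)"
  have summable: "summable (\<lambda>k. 1 / (real (Suc k))\<^sup>2)"
    using inverse_squares_sums by (simp add: sums_iff add.commute)
  have norm_f: "norm (f k x) \<le> 1 / (real (Suc k))\<^sup>2" for k x
    unfolding f_def by (auto simp: divide_right_mono)
  have unif: "uniform_limit UNIV V S sequentially"
    unfolding V_def S_def by (rule Weierstrass_m_test[OF norm_f summable])
  have cont: "continuous_on UNIV S"
    by (rule uniform_limit_theorem[OF _ unif])
       (auto simp: V_def f_def intro!: continuous_intros always_eventually)
  have lim: "(\<lambda>N. V N x) \<longlonglongrightarrow> S x" for x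
    using tendsto_uniform_limitI[OF unif] by auto
  define D where "D = (\<lambda>x. S x - pi\<^sup>2 * (x\<^sup>2 - x))"
  have D_const: "D x = D y" if "x \<in> {0<..<1}" "y \<in> {0<..<1}" for x y
  proof -
    define \<delta> where "\<delta> = Min {x, y, 1 - x, 1 - y}"
    have \<delta>: "0 < \<delta>" "x \<in> {\<delta>..1 - \<delta>}" "y \<in> {\<delta>..1 - \<delta>}"
      using that unfolding \<delta>_def by auto
    define W where "W = (\<lambda>N x. V N x - pi\<^sup>2 * (x\<^sup>2 - x))"
    have bound: "norm (W N x - W N y) \<le> 2 * pi\<^sup>2 * (2 / ((2 * real N + 1) * (sin (pi * \<delta>))\<^sup>2)) * norm (x - y)" for N
    proof (rule field_differentiable_bound[of "{\<delta>..1 - \<delta>}"])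
      fix t assume t: "t \<in> {\<delta>..1 - \<delta>}"
      let ?W' = "- 2 * pi\<^sup>2 * (t - 1 / 2 + (\<Sum>k=1..N. sin (2 * pi * real k * t) / (pi * real k)))"
      have "(W N has_field_derivative (\<Sum>k<N. - 2 * pi * sin (2 * pi * real (Suc k) * t) / real (Suc k))
               - pi\<^sup>2 * (2 * t - 1)) (at t within {\<delta>..1 - \<delta>})"
        unfolding W_def V_def f_def
        by (auto intro!: derivative_eq_intros sum.cong simp: power2_eq_square)
      also have "(\<Sum>k<N. - 2 * pi * sin (2 * pi * real (Suc k) * t) / real (Suc k)) - pi\<^sup>2 * (2 * t - 1) = ?W'"
      proof -
        have "(\<Sum>k=1..N. sin (2 * pi * real k * t) / (pi * real k))
            = (\<Sum>k<N. sin (2 * pi * real (Suc k) * t) / (pi * real (Suc k)))"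
          by (rule sum.reindex_bij_witness[of _ Suc "\<lambda>k. k - 1"]) auto
        moreover have "(\<Sum>k<N. - 2 * pi * sin (2 * pi * real (Suc k) * t) / real (Suc k))
            = - 2 * pi\<^sup>2 * (\<Sum>k<N. sin (2 * pi * real (Suc k) * t) / (pi * real (Suc k)))"
          unfolding sum_distrib_left by (intro sum.cong refl) (simp add: power2_eq_square)
        ultimately show ?thesis by (simp only:) (simp add: algebra_simps)
      qed
      finally show "(W N has_field_derivative ?W') (at t within {\<delta>..1 - \<delta>})" .
      have "norm ?W' = 2 * pi\<^sup>2 * \<bar>t - 1 / 2 + (\<Sum>k=1..N. sin (2 * pi * real k * t) / (pi * real k))\<bar>"
        by (simp add: abs_mult)
      also have "\<dots> \<le> 2 * pi\<^sup>2 * (2 / ((2 * real N + 1) * (sin (pi * \<delta>))\<^sup>2))"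
        by (intro mult_left_mono sawtooth_partial_sum_bound \<delta> t) auto
      finally show "norm ?W' \<le> 2 * pi\<^sup>2 * (2 / ((2 * real N + 1) * (sin (pi * \<delta>))\<^sup>2))" .
    qed (use \<delta> in auto)
    have "(\<lambda>N. 2 * pi\<^sup>2 * (2 / ((2 * real N + 1) * (sin (pi * \<delta>))\<^sup>2)) * norm (x - y)) \<longlonglongrightarrow> 0"
    proof -
      have "(\<lambda>N. 1 / (2 * real N + 1)) \<longlonglongrightarrow> 0" by real_asymp
      from tendsto_mult_right_zero[OF this, of "4 * pi\<^sup>2 / (sin (pi * \<delta>))\<^sup>2 * norm (x - y)"]
      show ?thesis by (simp add: mult_ac)
    qed
    then have "(\<lambda>N. W N x - W N y) \<longlonglongrightarrow> 0"
      by (rule Lim_null_comparison[rotated]) (rule always_eventually, rule allI, rule bound)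
    moreover have "(\<lambda>N. W N x - W N y) \<longlonglongrightarrow> D x - D y"
      unfolding W_def D_def by (intro tendsto_intros lim)
    ultimately show ?thesis using LIMSEQ_unique by force
  qed
  have cont_D: "continuous_on {0..1} D"
    unfolding D_def by (intro continuous_intros continuous_on_subset[OF cont]) auto
  have "D x = D (1 / 2)" if "x \<in> {0..1}" for x
  proof (rule continuous_constant_on_closure[of "{0<..<1}" D])
    show "D y = D (1 / 2)" if "y \<in> {0<..<1}" for y
      using that by (rule D_const) simp
  qed (use that cont_D in auto)
  from this[OF assms] this[of 0] have "S x - pi\<^sup>2 * (x\<^sup>2 - x) = S 0"
    unfolding D_def by simp
  moreover have "S 0 = pi\<^sup>2 / 6"
    using inverse_squares_sums unfolding S_def f_def by (simp add: sums_iff add.commute)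
  ultimately have "S x = pi\<^sup>2 * (x\<^sup>2 - x + 1 / 6)" by (simp add: algebra_simps)
  then show ?thesis using lim[of x] unfolding V_def f_def sums_def by simp
qed

text \<open>
The periodic extension of the Bernoulli polynomial \<open>x\<^sup>2 - x + 1/6\<close>. The polynomial takes equal
values at \<open>0\<close> and \<open>1\<close>, so on each closed interval between consecutive integers the extension is a
translate of it.
\<close>

definition bernoulli2 :: "real \<Rightarrow> real" where
  "bernoulli2 x = (frac x)\<^sup>2 - frac x + 1 / 6"

lemma bernoulli2_eq:
  assumes "x \<in> {of_int n..of_int n + 1}"
  shows "bernoulli2 x = (x - of_int n)\<^sup>2 - (x - of_int n) + 1 / 6"
proof (cases "x = of_int n + 1")
  case True
  then have "frac x = 0" by simp
  then show ?thesis using True by (simp add: bernoulli2_def)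
next
  case False
  then have "\<lfloor>x\<rfloor> = n" using assms by (intro floor_unique) auto
  then show ?thesis by (simp add: bernoulli2_def frac_def)
qed

lemma bernoulli2_sums:
  "(\<lambda>k. cos (2 * pi * real (Suc k) * x) / (pi * real (Suc k))\<^sup>2) sums bernoulli2 x"
proof -
  have period: "cos (2 * pi * real (Suc k) * frac x) = cos (2 * pi * real (Suc k) * x)" for k
  proof -
    have "2 * pi * real (Suc k) * x = 2 * pi * real (Suc k) * frac x + 2 * pi * of_int (int (Suc k) * \<lfloor>x\<rfloor>)"
      by (simp add: frac_def algebra_simps)
    then have "cos (2 * pi * real (Suc k) * x) = cos (2 * pi * real (Suc k) * frac x + 2 * pi * of_int (int (Suc k) * \<lfloor>x\<rfloor>))"
      by (rule arg_cong)
    also have "\<dots> = cos (2 * pi * real (Suc k) * frac x)"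
      unfolding cos_add cos_int_2pin sin_int_2pin by (simp only: mult_1_right mult_zero_right diff_zero)
    finally show ?thesis by (rule sym)
  qed
  have "frac x \<in> {0..1}" using frac_ge_0[of x] frac_lt_1[of x] by simp
  from bernoulli2_cosine_series[OF this]
  have "(\<lambda>k. cos (2 * pi * real (Suc k) * x) / (real (Suc k))\<^sup>2) sums (pi\<^sup>2 * bernoulli2 x)"
    unfolding period bernoulli2_def .
  then have "(\<lambda>k. cos (2 * pi * real (Suc k) * x) / (real (Suc k))\<^sup>2 / pi\<^sup>2) sums (pi\<^sup>2 * bernoulli2 x / pi\<^sup>2)"
    by (rule sums_divide)
  moreover have "c / (real (Suc k))\<^sup>2 / pi\<^sup>2 = c / (pi * real (Suc k))\<^sup>2" for c k
    by (simp only: power_mult_distrib divide_divide_eq_left mult.commute[of "pi\<^sup>2"])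
  moreover have "pi\<^sup>2 * bernoulli2 x / pi\<^sup>2 = bernoulli2 x"
    using pi_neq_zero by (intro nonzero_mult_div_cancel_left) (rule power_not_zero)
  ultimately show ?thesis by (simp only:)
qed

lemma bernoulli2_bound: "\<bar>bernoulli2 x\<bar> \<le> 1"
proof -
  have frac: "0 \<le> frac x" "0 \<le> 1 - frac x" using frac_ge_0[of x] frac_lt_1[of x] by linarith+
  have "0 \<le> frac x * (1 - frac x)" using frac by (rule mult_nonneg_nonneg)
  moreover have "frac x * (1 - frac x) \<le> 1"
    by (rule mult_le_one) (use frac in auto)
  moreover have "bernoulli2 x = 1 / 6 - frac x * (1 - frac x)"
    unfolding bernoulli2_def power2_eq_square right_diff_distrib by simp
  ultimately show ?thesis by linarith
qed

section \<open>Poisson summation for functions of quadratic decay\<close>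

lemma filterlim_symmetric_int_intervals:
  "filterlim (\<lambda>N. {- int N..int N}) (finite_subsets_at_top UNIV) sequentially"
  unfolding filterlim_finite_subsets_at_top
proof safe
  fix X :: "int set" assume X: "finite X"
  show "eventually (\<lambda>N. finite {- int N..int N} \<and> X \<subseteq> {- int N..int N} \<and> {- int N..int N} \<subseteq> UNIV) sequentially"
    unfolding eventually_sequentially
  proof (intro exI allI impI)
    fix N assume N: "nat (\<Sum>k\<in>X. \<bar>k\<bar>) \<le> N"
    have "\<bar>k\<bar> \<le> (\<Sum>k\<in>X. \<bar>k\<bar>)" if "k \<in> X" for k
      using X that by (intro member_le_sum) auto
    then have "\<bar>k\<bar> \<le> int N" if "k \<in> X" for k using N that by fastforce
    then show "finite {- int N..int N} \<and> X \<subseteq> {- int N..int N} \<and> {- int N..int N} \<subseteq> UNIV" 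
      by (fastforce simp: abs_le_iff)
  qed
qed

lemma has_sum_int_imp_symmetric_limit:
  assumes "(f has_sum s) (UNIV :: int set)"
  shows "(\<lambda>N. \<Sum>k=- int N..int N. f k) \<longlonglongrightarrow> s"
  using filterlim_compose[OF assms[unfolded has_sum_def] filterlim_symmetric_int_intervals] .

lemma sum_symmetric_int_Suc:
  fixes f :: "int \<Rightarrow> 'a::ab_group_add"
  shows "(\<Sum>k=- int (Suc N)..int (Suc N). f k) = (\<Sum>k=- int N..int N. f k) + (f (int (Suc N)) + f (- int (Suc N)))"
proof -
  have "{- int (Suc N)..int (Suc N)} = insert (int (Suc N)) (insert (- int (Suc N)) {- int N..int N})"
    by auto
  then show ?thesis by (simp add: ac_simps)
qed

text \<open>
This rate makes a continuous function integrable and its restriction to the integers absolutely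
summable, and unlike membership in the Schwartz space it is easy to check for the two derivatives
that Poisson summation involves.
\<close>

definition quadratic_decay :: "(real \<Rightarrow> complex) \<Rightarrow> bool" where
  "quadratic_decay f \<longleftrightarrow> (\<exists>C. \<forall>x. norm (f x) \<le> C * inverse (1 + x\<^sup>2))"

lemma quadratic_decayI: "(\<And>x. norm (f x) \<le> C * inverse (1 + x\<^sup>2)) \<Longrightarrow> quadratic_decay f"
  unfolding quadratic_decay_def by blast

lemma quadratic_decay_add:
  assumes "quadratic_decay f" "quadratic_decay g"
  shows "quadratic_decay (\<lambda>x. f x + g x)"
proof -
  obtain C D where "norm (f x) \<le> C * inverse (1 + x\<^sup>2)" "norm (g x) \<le> D * inverse (1 + x\<^sup>2)" for x
    using assms unfolding quadratic_decay_def by blast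
  then have "norm (f x + g x) \<le> (C + D) * inverse (1 + x\<^sup>2)" for x
    unfolding distrib_right by (rule norm_triangle_mono)
  then show ?thesis by (rule quadratic_decayI)
qed

lemma quadratic_decay_mult_bounded:
  assumes "quadratic_decay f" "\<And>x. norm (w x) \<le> B"
  shows "quadratic_decay (\<lambda>x. w x * f x)"
proof -
  obtain C where "norm (f x) \<le> C * inverse (1 + x\<^sup>2)" for x
    using assms unfolding quadratic_decay_def by blast
  then have "norm (w x * f x) \<le> B * (C * inverse (1 + x\<^sup>2))" for x
    unfolding norm_mult using assms(2) order_trans[OF norm_ge_zero assms(2)] by (intro mult_mono) auto
  then show ?thesis by (intro quadratic_decayI[of _ "B * C"]) (simp add: mult.assoc)
qed

lemma quadratic_decay_cmult: "quadratic_decay f \<Longrightarrow> quadratic_decay (\<lambda>x. c * f x)"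
  by (rule quadratic_decay_mult_bounded[where B = "norm c"]) auto

lemma quadratic_decay_integrable:
  assumes "quadratic_decay f" "continuous_on UNIV f"
  shows "integrable lborel f"
proof -
  obtain C where C: "norm (f x) \<le> C * inverse (1 + x\<^sup>2)" for x
    using assms unfolding quadratic_decay_def by blast
  show ?thesis
  proof (rule Bochner_Integration.integrable_bound[OF integrable_mult_right[OF
          lborel_integrable_inverse_1_plus_square, of C]])
    show "f \<in> borel_measurable lborel"
      using borel_measurable_continuous_onI[OF assms(2)] by simp
  qed (use C in \<open>auto intro: order_trans[OF _ abs_ge_self]\<close>)
qed

lemma quadratic_decay_abs_summable_int:
  assumes "quadratic_decay f"
  shows "(\<lambda>k::int. norm (f (of_int k))) summable_on UNIV"
proof -
  obtain C where C: "norm (f x) \<le> C * inverse (1 + x\<^sup>2)" for x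
    using assms unfolding quadratic_decay_def by blast
  show ?thesis
    by (rule summable_on_comparison_test[OF summable_on_cmult_right[OF
          summable_on_int_inverse_1_plus_square, of C]]) (use C in auto)
qed

lemma quadratic_decay_tendsto_0:
  assumes "quadratic_decay f"
  shows "(\<lambda>N. f (real N)) \<longlonglongrightarrow> 0" "(\<lambda>N. f (- real N)) \<longlonglongrightarrow> 0"
proof -
  obtain C where C: "norm (f x) \<le> C * inverse (1 + x\<^sup>2)" for x
    using assms unfolding quadratic_decay_def by blast
  have lim: "(\<lambda>N. C * inverse (1 + (real N)\<^sup>2)) \<longlonglongrightarrow> 0"
  proof -
    have "(\<lambda>N. inverse (1 + (real N)\<^sup>2)) \<longlonglongrightarrow> 0" by real_asymp
    then show ?thesis by (rule tendsto_mult_right_zero)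
  qed
  show "(\<lambda>N. f (real N)) \<longlonglongrightarrow> 0"
    by (rule Lim_null_comparison[OF _ lim]) (rule always_eventually, rule allI, rule C)
  show "(\<lambda>N. f (- real N)) \<longlonglongrightarrow> 0"
    by (rule Lim_null_comparison[OF _ lim]) (rule always_eventually, rule allI, use C[of "- real _"] in simp)
qed

lemma integral_symmetric_limit:
  fixes f :: "real \<Rightarrow> complex"
  assumes "integrable lborel f"
  shows "(\<lambda>N. LINT x:{- real N..real N}|lborel. f x) \<longlonglongrightarrow> (LINT x|lborel. f x)"
  unfolding set_lebesgue_integral_def
proof (rule integral_dominated_convergence[where w = "\<lambda>x. norm (f x)"])
  show "AE x in lborel. (\<lambda>N. indicator {- real N..real N} x *\<^sub>R f x) \<longlonglongrightarrow> f x"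
  proof (rule AE_I2)
    fix x :: real
    have "eventually (\<lambda>N. x \<in> {- real N..real N}) sequentially"
    proof -
      obtain M where "\<bar>x\<bar> \<le> real M" using real_arch_simple by blast
      then show ?thesis unfolding eventually_sequentially by (intro exI[of _ M]) auto
    qed
    then show "(\<lambda>N. indicator {- real N..real N} x *\<^sub>R f x) \<longlonglongrightarrow> f x"
      by (intro tendsto_eventually) (auto elim: eventually_mono)
  qed
qed (use assms in \<open>auto simp: indicator_def\<close>)

text \<open>
The form in which integration by parts on the whole line is used: no boundary terms at infinity.
\<close>

lemma integral_derivative_eq_0:
  assumes deriv: "\<And>x. (f has_vector_derivative f' x) (at x)"
    and decay: "quadratic_decay f" "quadratic_decay f'" and cont: "continuous_on UNIV f'"
  shows "(LINT x|lborel. f' x) = 0"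
proof -
  have "(LINT x:{- real N..real N}|lborel. f' x) = f (real N) - f (- real N)" for N
    unfolding set_lebesgue_integral_def
    by (rule integral_FTC_atLeastAtMost)
       (auto intro: has_vector_derivative_at_within deriv continuous_on_subset[OF cont])
  moreover have "(\<lambda>N. f (real N) - f (- real N)) \<longlonglongrightarrow> 0 - 0"
    by (intro tendsto_diff quadratic_decay_tendsto_0 decay)
  ultimately show ?thesis
    using LIMSEQ_unique[OF integral_symmetric_limit[OF quadratic_decay_integrable[OF decay(2) cont]]] by simp
qed

lemma has_vector_derivative_cis_linear:
  "((\<lambda>x. cis (c * x)) has_vector_derivative \<i> * of_real c * cis (c * x)) (at x within S)"
proof -
  have "((\<lambda>x. exp (\<i> * of_real c * of_real x)) has_vector_derivative
      (\<i> * of_real c) * exp (\<i> * of_real c * of_real x)) (at x within S)"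
    by (rule has_vector_derivative_real_field) (auto intro!: derivative_eq_intros)
  then show ?thesis by (simp add: cis_conv_exp mult.assoc)
qed

lemma set_integral_Icc_combine:
  fixes f :: "real \<Rightarrow> complex"
  assumes "integrable lborel f" "a \<le> b" "b \<le> c"
  shows "(LINT x:{a..c}|lborel. f x) = (LINT x:{a..b}|lborel. f x) + (LINT x:{b..c}|lborel. f x)"
proof -
  have "(LINT x:{a..b} \<union> {b..c}|lborel. f x) = (LINT x:{a..b}|lborel. f x) + (LINT x:{b..c}|lborel. f x)"
  proof (rule set_integral_Un_AE)
    show "AE x in lborel. \<not> (x \<in> {a..b} \<and> x \<in> {b..c})"
      using AE_lborel_singleton[of b] by eventually_elim auto
  qed (use assms in \<open>auto simp: set_integrable_def intro!: integrable_real_mult_indicator integrable_mult_indicator\<close>)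
  moreover have "{a..b} \<union> {b..c} = {a..c}" using assms by auto
  ultimately show ?thesis by simp
qed

lemma integrable_mult_bounded:
  fixes w :: "real \<Rightarrow> complex"
  assumes "w \<in> borel_measurable borel" "\<And>x. norm (w x) \<le> 1" "integrable lborel f"
  shows "integrable lborel (\<lambda>x. f x * w x)"
proof (rule Bochner_Integration.integrable_bound[OF assms(3)])
  show "AE x in lborel. norm (f x * w x) \<le> norm (f x)"
    using assms(2) by (auto simp: norm_mult intro!: mult_left_le)
  show "(\<lambda>x. f x * w x) \<in> borel_measurable lborel"
    using assms(1) borel_measurable_integrable[OF assms(3)] by simp
qed

lemma cis_measurable: "(\<lambda>x. cis (c * x)) \<in> borel_measurable borel"
  by (intro borel_measurable_continuous_onI continuous_intros)

text \<open>
The regularity under which Poisson summation is proved; the derivatives are arguments so that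
they can be given by explicit formulas.
\<close>

definition c2_decay :: "(real \<Rightarrow> complex) \<Rightarrow> (real \<Rightarrow> complex) \<Rightarrow> (real \<Rightarrow> complex) \<Rightarrow> bool" where
  "c2_decay g g' g'' \<longleftrightarrow>
     (\<forall>x. (g has_vector_derivative g' x) (at x)) \<and> (\<forall>x. (g' has_vector_derivative g'' x) (at x)) \<and>
     continuous_on UNIV g'' \<and> quadratic_decay g \<and> quadratic_decay g' \<and> quadratic_decay g''"

context
  fixes g g' g'' :: "real \<Rightarrow> complex"
  assumes c2: "c2_decay g g' g''"
begin

lemma c2_decay_deriv: "(g has_vector_derivative g' x) (at x within S)"
  and c2_decay_deriv': "(g' has_vector_derivative g'' x) (at x within S)"
  using c2 unfolding c2_decay_def by (blast intro: has_vector_derivative_at_within)+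

lemma c2_decay_cont: "continuous_on S g" and c2_decay_cont'': "continuous_on S g''"
  using c2 unfolding c2_decay_def
  by (blast intro: continuous_on_vector_derivative c2_decay_deriv c2_decay_deriv' continuous_on_subset)+

lemma c2_decay_decays: "quadratic_decay g" "quadratic_decay g'" "quadratic_decay g''"
  using c2 unfolding c2_decay_def by blast+

lemma c2_decay_integrable: "integrable lborel g" "integrable lborel g''"
  by (intro quadratic_decay_integrable c2_decay_decays c2_decay_cont c2_decay_cont'')+

lemma bernoulli2_term_integrable: "integrable lborel (\<lambda>x. g'' x * of_real (bernoulli2 x / 2))"
proof (rule integrable_mult_bounded[OF _ _ c2_decay_integrable(2)])
  have [measurable]: "bernoulli2 \<in> borel_measurable borel"
    unfolding bernoulli2_def frac_def by measurable
  show "(\<lambda>x. complex_of_real (bernoulli2 x / 2)) \<in> borel_measurable borel" by measurable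
  show "norm (complex_of_real (bernoulli2 x / 2)) \<le> 1" for x
    using bernoulli2_bound[of x] by simp
qed

lemma euler_maclaurin_integrable: "integrable lborel (\<lambda>x. g x - g'' x * of_real (bernoulli2 x / 2))"
  by (intro Bochner_Integration.integrable_diff c2_decay_integrable bernoulli2_term_integrable)

text \<open>
Integrating \<open>g'' e\<close> by parts twice, with \<open>e(x) = cis (c x)\<close>: the boundary terms combine to
\<open>g' e - g e'\<close>, whose derivative is \<open>g'' e - g e'' = (g'' + c\<^sup>2 g) e\<close>.
\<close>

lemma fourier_second_derivative:
  "(LINT x|lborel. g'' x * cis (c * x)) = - of_real (c\<^sup>2) * (LINT x|lborel. g x * cis (c * x))"
proof -
  define G where "G = (\<lambda>x. g' x * cis (c * x) - \<i> * of_real c * g x * cis (c * x))"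
  define G' where "G' = (\<lambda>x. g'' x * cis (c * x) + of_real (c\<^sup>2) * (g x * cis (c * x)))"
  have "(LINT x|lborel. G' x) = 0"
  proof (rule integral_derivative_eq_0)
    show "(G has_vector_derivative G' x) (at x)" for x
    proof -
      have "(G has_vector_derivative
          (g' x * (\<i> * of_real c * cis (c * x)) + g'' x * cis (c * x)) -
          (\<i> * of_real c * g x * (\<i> * of_real c * cis (c * x)) + (\<i> * of_real c * g' x) * cis (c * x))) (at x)"
        unfolding G_def
        by (intro has_vector_derivative_diff has_vector_derivative_mult has_vector_derivative_cis_linear
            has_vector_derivative_mult_right c2_decay_deriv c2_decay_deriv')
      then show ?thesis unfolding G'_def by (simp add: algebra_simps power2_eq_square)
    qed
    have "quadratic_decay (\<lambda>x. cis (c * x) * g' x + (- \<i> * of_real c) * (cis (c * x) * g x))"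
      by (intro quadratic_decay_add quadratic_decay_cmult quadratic_decay_mult_bounded[where B = 1] c2_decay_decays) auto
    then show "quadratic_decay G" unfolding G_def by (simp add: mult_ac)
    have "quadratic_decay (\<lambda>x. cis (c * x) * g'' x + of_real (c\<^sup>2) * (cis (c * x) * g x))"
      by (intro quadratic_decay_add quadratic_decay_cmult quadratic_decay_mult_bounded[where B = 1] c2_decay_decays) auto
    then show "quadratic_decay G'" unfolding G'_def by (simp add: mult_ac)
    show "continuous_on UNIV G'" unfolding G'_def by (intro continuous_intros c2_decay_cont c2_decay_cont'')
  qed
  then show ?thesis
    unfolding G'_def
    by (subst (asm) Bochner_Integration.integral_add)
       (auto intro!: integrable_mult_bounded cis_measurable c2_decay_integrable integrable_mult_right simp: eq_neg_iff_add_eq_0)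
qed

text \<open>
On an interval between integers, \<open>r = B\<^sub>2 / 2\<close> is a polynomial with \<open>r'' = 1\<close>, so the integrand
\<open>g - g'' r\<close> is the derivative of \<open>r' g - r g'\<close>. At the end points \<open>r' = \<plusminus> 1/2\<close> and \<open>r = 1/12\<close>.
\<close>

lemma euler_maclaurin_step:
  "(LINT x:{of_int n..of_int n + 1}|lborel. g x - g'' x * of_real (bernoulli2 x / 2))
     = (g (of_int n) + g (of_int n + 1)) / 2 - (g' (of_int n + 1) - g' (of_int n)) / 12"
proof -
  let ?I = "{of_int n..of_int n + 1 :: real}"
  define r where "r = (\<lambda>x::real. ((x - of_int n)\<^sup>2 - (x - of_int n) + 1 / 6) / 2)"
  define r' where "r' = (\<lambda>x::real. (x - of_int n) - 1 / 2)"
  define F where "F = (\<lambda>x. of_real (r' x) * g x - of_real (r x) * g' x)"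
  have "(LINT x:?I|lborel. g x - g'' x * of_real (bernoulli2 x / 2)) = (LINT x:?I|lborel. g x - g'' x * of_real (r x))"
    by (rule set_lebesgue_integral_cong) (auto simp: bernoulli2_eq[of _ n] r_def)
  also have "\<dots> = F (of_int n + 1) - F (of_int n)"
    unfolding set_lebesgue_integral_def
  proof (rule integral_FTC_atLeastAtMost)
    fix x
    have r: "((\<lambda>x. complex_of_real (r x)) has_vector_derivative of_real (r' x)) (at x within ?I)"
      unfolding r_def r'_def
      by (rule has_vector_derivative_of_real) (auto intro!: derivative_eq_intros simp: field_simps)
    have r': "((\<lambda>x. complex_of_real (r' x)) has_vector_derivative of_real 1) (at x within ?I)"
      unfolding r'_def by (rule has_vector_derivative_of_real) (auto intro!: derivative_eq_intros)
    have "(F has_vector_derivative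
        (of_real (r' x) * g' x + of_real 1 * g x) - (of_real (r x) * g'' x + of_real (r' x) * g' x)) (at x within ?I)"
      unfolding F_def by (intro has_vector_derivative_diff has_vector_derivative_mult r r' c2_decay_deriv c2_decay_deriv')
    then show "(F has_vector_derivative g x - g'' x * of_real (r x)) (at x within ?I)" 
      by (simp add: mult_ac)
  qed (auto simp: r_def intro!: continuous_intros c2_decay_cont c2_decay_cont'')
  also have "\<dots> = (g (of_int n) + g (of_int n + 1)) / 2 - (g' (of_int n + 1) - g' (of_int n)) / 12"
    unfolding F_def r_def r'_def by (simp add: field_simps)
  finally show ?thesis .
qed


text \<open>
The terms with \<open>g'\<close> telescope, and the trapezoidal sums add up to the full sum, with weight one
half on the two end points.
\<close>

lemma euler_maclaurin_partial:
  "(LINT x:{- real N..real N}|lborel. g x - g'' x * of_real (bernoulli2 x / 2))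
     = (\<Sum>n=- int N..int N. g (of_int n)) - (g (real N) + g (- real N)) / 2 - (g' (real N) - g' (- real N)) / 12"
proof (induction N)
  case 0
  have "(LINT x:{- real 0..real 0}|lborel. g x - g'' x * of_real (bernoulli2 x / 2)) = 0"
    unfolding set_lebesgue_integral_def
  proof (rule integral_eq_zero_AE)
    show "AE x in lborel. indicator {- real 0..real 0} x *\<^sub>R (g x - g'' x * of_real (bernoulli2 x / 2)) = 0"
      using AE_lborel_singleton[of 0] by eventually_elim simp
  qed
  then show ?case by simp
next
  case (Suc N)
  let ?f = "\<lambda>x. g x - g'' x * of_real (bernoulli2 x / 2)"
  have "integrable lborel ?f" by (rule euler_maclaurin_integrable)
  then have total: "(LINT x:{- real (Suc N)..real (Suc N)}|lborel. ?f x) =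
      (LINT x:{- real (Suc N)..- real N}|lborel. ?f x)
      + ((LINT x:{- real N..real N}|lborel. ?f x) + (LINT x:{real N..real (Suc N)}|lborel. ?f x))"
    by (subst set_integral_Icc_combine[of _ _ "- real N"], simp_all)
       (subst set_integral_Icc_combine[of _ _ "real N"], simp_all)
  have left: "(LINT x:{- real (Suc N)..- real N}|lborel. ?f x)
      = (g (- real (Suc N)) + g (- real N)) / 2 - (g' (- real N) - g' (- real (Suc N))) / 12"
    using euler_maclaurin_step[of "- int (Suc N)"] by simp
  have right: "(LINT x:{real N..real (Suc N)}|lborel. ?f x)
      = (g (real N) + g (real (Suc N))) / 2 - (g' (real (Suc N)) - g' (real N)) / 12"
    using euler_maclaurin_step[of "int N"] by (simp add: add.commute)
  show ?case
    unfolding sum_symmetric_int_Suc total left right Suc.IH by (simp add: field_simps)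
qed

lemma euler_maclaurin:
  "(LINT x|lborel. g x - g'' x * of_real (bernoulli2 x / 2)) = (\<Sum>\<^sub>\<infinity>n::int. g (of_int n))"
proof (rule LIMSEQ_unique)
  show "(\<lambda>N. LINT x:{- real N..real N}|lborel. g x - g'' x * of_real (bernoulli2 x / 2))
          \<longlonglongrightarrow> (LINT x|lborel. g x - g'' x * of_real (bernoulli2 x / 2))"
    by (rule integral_symmetric_limit[OF euler_maclaurin_integrable])
  have "((\<lambda>n::int. g (of_int n)) has_sum (\<Sum>\<^sub>\<infinity>n. g (of_int n))) UNIV"
    by (rule has_sum_infsum[OF abs_summable_summable[OF quadratic_decay_abs_summable_int[OF c2_decay_decays(1)]]])
  then have "(\<lambda>N. \<Sum>n=- int N..int N. g (of_int n)) \<longlonglongrightarrow> (\<Sum>\<^sub>\<infinity>n::int. g (of_int n))"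
    by (rule has_sum_int_imp_symmetric_limit)
  moreover have "(\<lambda>N. (g (real N) + g (- real N)) / 2) \<longlonglongrightarrow> (0 + 0) / 2"
    by (intro tendsto_divide tendsto_add tendsto_const quadratic_decay_tendsto_0 c2_decay_decays) simp
  moreover have "(\<lambda>N. (g' (real N) - g' (- real N)) / 12) \<longlonglongrightarrow> (0 - 0) / 12"
    by (intro tendsto_divide tendsto_diff tendsto_const quadratic_decay_tendsto_0 c2_decay_decays) simp
  ultimately have "(\<lambda>N. LINT x:{- real N..real N}|lborel. g x - g'' x * of_real (bernoulli2 x / 2))
          \<longlonglongrightarrow> (\<Sum>\<^sub>\<infinity>n::int. g (of_int n)) - (0 + 0) / 2 - (0 - 0) / 12"
    unfolding euler_maclaurin_partial by (intro tendsto_diff)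
  then show "(\<lambda>N. LINT x:{- real N..real N}|lborel. g x - g'' x * of_real (bernoulli2 x / 2))
          \<longlonglongrightarrow> (\<Sum>\<^sub>\<infinity>n::int. g (of_int n))"
    by (simp only: add_0 diff_0_right div_0)
qed

definition fourier_at :: "int \<Rightarrow> complex" where
  "fourier_at k = (LINT x|lborel. g x * cis (- (2 * pi * of_int k) * x))"

lemma fourier_at_eq:
  "k \<noteq> 0 \<Longrightarrow> fourier_at k = - (LINT x|lborel. g'' x * cis (- (2 * pi * of_int k) * x)) / of_real ((2 * pi * of_int k)\<^sup>2)"
  unfolding fourier_at_def fourier_second_derivative by simp

lemma fourier_at_abs_summable: "(\<lambda>k. norm (fourier_at k)) summable_on UNIV"
proof -
  define K where "K = norm (fourier_at 0) + (LINT x|lborel. norm (g'' x))"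
  have K: "0 \<le> (LINT x|lborel. norm (g'' x))" by simp
  have "norm (fourier_at k) \<le> K * inverse (1 + (of_int k)\<^sup>2)" for k
  proof (cases "k = 0")
    case True
    then show ?thesis unfolding K_def by simp
  next
    case False
    have "norm (LINT x|lborel. g'' x * cis (- (2 * pi * of_int k) * x)) \<le> (LINT x|lborel. norm (g'' x))"
      using integral_norm_bound[of lborel "\<lambda>x. g'' x * cis (- (2 * pi * of_int k) * x)"] by (simp add: norm_mult)
    also have "\<dots> \<le> K" unfolding K_def by simp
    finally have num: "norm (LINT x|lborel. g'' x * cis (- (2 * pi * of_int k) * x)) \<le> K" .
    have "1 \<le> \<bar>k\<bar>" using False by linarith
    then have k: "1 \<le> (real_of_int k)\<^sup>2"
      by (metis of_int_1_le_iff of_int_power one_le_power power2_abs)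
    have "1\<^sup>2 \<le> pi\<^sup>2" using pi_gt3 by (intro power_mono) auto
    then have "2 * (real_of_int k)\<^sup>2 \<le> (2 * pi)\<^sup>2 * (real_of_int k)\<^sup>2"
      by (intro mult_right_mono) (auto simp: power_mult_distrib)
    with k have den: "1 + (real_of_int k)\<^sup>2 \<le> (2 * pi * of_int k)\<^sup>2"
      unfolding power_mult_distrib by linarith
    have "norm (fourier_at k) = norm (LINT x|lborel. g'' x * cis (- (2 * pi * of_int k) * x)) / (2 * pi * of_int k)\<^sup>2"
      using False by (simp add: fourier_at_eq norm_divide norm_power norm_mult power_mult_distrib)
    also have "\<dots> \<le> K / (1 + (of_int k)\<^sup>2)"
      using num den K by (intro frac_le) (auto simp: K_def add_pos_nonneg)
    finally show ?thesis by (simp add: divide_inverse)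
  qed
  then show ?thesis
    by (intro summable_on_comparison_test[OF summable_on_cmult_right[OF
          summable_on_int_inverse_1_plus_square, of K]]) auto
qed

text \<open>
The sum and the integral are exchanged by dominated convergence: the terms are bounded by
\<open>norm (g'' x) / k\<^sup>2\<close>. Pairing \<open>k\<close> with \<open>- k\<close> turns the exponentials into the cosines of the series
for \<open>B\<^sub>2\<close>.
\<close>

lemma fourier_at_pair_sums:
  "(\<lambda>k. fourier_at (int (Suc k)) + fourier_at (- int (Suc k))) sums (LINT x|lborel. - g'' x * of_real (bernoulli2 x / 2))"
proof -
  define f where "f = (\<lambda>k x. - g'' x * of_real (cos (2 * pi * real (Suc k) * x) / (pi * real (Suc k))\<^sup>2 / 2))"
  have f_eq: "f k x = g'' x * of_real (cos (2 * pi * real (Suc k) * x)) * of_real (- 1 / (pi * real (Suc k))\<^sup>2 / 2)" for k x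
    unfolding f_def by (simp add: field_simps)
  have norm_f: "norm (f k x) \<le> norm (g'' x) * (1 / (real (Suc k))\<^sup>2)" for k x
  proof -
    have "1\<^sup>2 \<le> pi\<^sup>2" using pi_gt3 by (intro power_mono) auto
    then have "1 * (real (Suc k))\<^sup>2 \<le> (pi\<^sup>2 * 2) * (real (Suc k))\<^sup>2"
      by (intro mult_right_mono) auto
    then have "\<bar>cos (2 * pi * real (Suc k) * x)\<bar> / ((pi * real (Suc k))\<^sup>2 * 2) \<le> 1 / (real (Suc k))\<^sup>2"
      by (intro frac_le) (simp_all add: power_mult_distrib)
    then show ?thesis unfolding f_def norm_mult norm_minus_cancel norm_of_real
      by (intro mult_left_mono) (simp_all add: abs_mult)
  qed
  have summable: "summable (\<lambda>k. 1 / (real (Suc k))\<^sup>2)"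
    using inverse_squares_sums by (simp add: sums_iff add.commute)
  have int_f: "integrable lborel (f k)" for k
  proof -
    have "integrable lborel (\<lambda>x. g'' x * of_real (cos (2 * pi * real (Suc k) * x)))"
    proof (rule integrable_mult_bounded[OF _ _ c2_decay_integrable(2)])
      show "(\<lambda>x. complex_of_real (cos (2 * pi * real (Suc k) * x))) \<in> borel_measurable borel"
        by measurable
    qed simp
    then have "integrable lborel (\<lambda>x. f k x)"
      unfolding f_eq by (rule integrable_mult_left)
    then show ?thesis .
  qed
  have "(\<lambda>k. LINT x|lborel. f k x) sums (LINT x|lborel. (\<Sum>k. f k x))"
  proof (rule sums_integral[OF int_f])
    show "AE x in lborel. summable (\<lambda>k. norm (f k x))"
    proof (rule AE_I2)
      fix x
      show "summable (\<lambda>k. norm (f k x))"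
        by (rule summable_comparison_test'[OF summable_mult[OF summable, of "norm (g'' x)"]]) (use norm_f in auto)
    qed
    show "summable (\<lambda>k. LINT x|lborel. norm (f k x))"
    proof (rule summable_comparison_test'[OF summable_mult[OF summable, of "LINT x|lborel. norm (g'' x)"]])
      fix k
      have "(LINT x|lborel. norm (f k x)) \<le> (LINT x|lborel. norm (g'' x) * (1 / (real (Suc k))\<^sup>2))"
        by (intro integral_mono integrable_norm int_f integrable_mult_left c2_decay_integrable norm_f)
      then show "norm (LINT x|lborel. norm (f k x)) \<le> (LINT x|lborel. norm (g'' x)) * (1 / (real (Suc k))\<^sup>2)"
        by (simp add: Bochner_Integration.integral_nonneg)
    qed
  qed
  moreover have "(\<Sum>k. f k x) = - g'' x * of_real (bernoulli2 x / 2)" for x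
    unfolding f_def
    by (intro sums_unique[symmetric] sums_mult sums_of_real sums_divide bernoulli2_sums)
  moreover have "(LINT x|lborel. f k x) = fourier_at (int (Suc k)) + fourier_at (- int (Suc k))" for k
  proof -
    let ?c = "2 * pi * real (Suc k)"
    have int_cis: "integrable lborel (\<lambda>x. g'' x * cis (c * x))" for c
      by (rule integrable_mult_bounded[OF cis_measurable _ c2_decay_integrable(2)]) simp
    have "cis (- t) + cis t = 2 * of_real (cos t)" for t by (simp add: complex_eq_iff)
    then have "f k x = (g'' x * cis (- ?c * x) + g'' x * cis (?c * x)) * (- 1 / of_real (?c\<^sup>2))" for x
      unfolding f_eq distrib_left[symmetric] by (simp add: field_simps power2_eq_square del: of_nat_Suc)
    then have "(LINT x|lborel. f k x) =
        ((LINT x|lborel. g'' x * cis (- ?c * x)) + (LINT x|lborel. g'' x * cis (?c * x))) * (- 1 / of_real (?c\<^sup>2))"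
      by (simp only: integral_mult_left_zero Bochner_Integration.integral_add[OF int_cis int_cis])
    moreover have "fourier_at (int (Suc k)) = (LINT x|lborel. g'' x * cis (- ?c * x)) * (- 1 / of_real (?c\<^sup>2))"
      using fourier_at_eq[of "int (Suc k)"] by (simp del: of_nat_Suc)
    moreover have "fourier_at (- int (Suc k)) = (LINT x|lborel. g'' x * cis (?c * x)) * (- 1 / of_real (?c\<^sup>2))"
      using fourier_at_eq[of "- int (Suc k)"] by (simp del: of_nat_Suc)
    ultimately show ?thesis unfolding distrib_right by simp
  qed
  ultimately show ?thesis by simp
qed

text \<open>
The symmetric partial sums of the Fourier side converge to the integral of \<open>g - g'' B\<^sub>2 / 2\<close>,
which Euler-Maclaurin evaluates. As the Fourier side is absolutely summable, its unordered sum is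
this limit.
\<close>

lemma poisson_summation:
  "((\<lambda>k::int. LINT x|lborel. g x * cis (- (2 * pi * of_int k) * x)) has_sum (\<Sum>\<^sub>\<infinity>n::int. g (of_int n))) UNIV"
proof -
  have sums: "(fourier_at has_sum infsum fourier_at UNIV) UNIV"
    by (rule has_sum_infsum[OF abs_summable_summable[OF fourier_at_abs_summable]])
  have partial: "(\<Sum>k=- int N..int N. fourier_at k) = fourier_at 0
      + (\<Sum>k<N. fourier_at (int (Suc k)) + fourier_at (- int (Suc k)))" for N
  proof (induction N)
    case 0
    show ?case by simp
  next
    case (Suc N)
    show ?case unfolding sum_symmetric_int_Suc Suc.IH sum.lessThan_Suc add.assoc ..
  qed
  have "infsum fourier_at UNIV = fourier_at 0 + (LINT x|lborel. - g'' x * of_real (bernoulli2 x / 2))"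
  proof (rule LIMSEQ_unique)
    show "(\<lambda>N. \<Sum>k=- int N..int N. fourier_at k) \<longlonglongrightarrow> infsum fourier_at UNIV"
      by (rule has_sum_int_imp_symmetric_limit[OF sums])
    show "(\<lambda>N. \<Sum>k=- int N..int N. fourier_at k)
        \<longlonglongrightarrow> fourier_at 0 + (LINT x|lborel. - g'' x * of_real (bernoulli2 x / 2))"
      unfolding partial by (intro tendsto_add tendsto_const fourier_at_pair_sums[unfolded sums_def])
  qed
  also have "\<dots> = (LINT x|lborel. g x - g'' x * of_real (bernoulli2 x / 2))"
    unfolding fourier_at_def
    using Bochner_Integration.integral_diff[OF c2_decay_integrable(1) bernoulli2_term_integrable] by simp
  also have "\<dots> = (\<Sum>\<^sub>\<infinity>n::int. g (of_int n))" by (rule euler_maclaurin)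
  finally show ?thesis using sums unfolding fourier_at_def by simp
qed

end

section \<open>Schwartz functions times a quadratic chirp\<close>

lemma schwartz_has_vector_derivative:
  assumes "f \<in> schwartz"
  shows "((vderiv ^^ n) f has_vector_derivative (vderiv ^^ Suc n) f x) (at x)"
proof -
  have "(vderiv ^^ n) f differentiable at x" using assms unfolding schwartz_def by blast
  then show ?thesis by (simp add: vector_derivative_works vderiv_def)
qed

text \<open>
A power \<open>x\<^sup>j\<close> is controlled by the seminorms of orders \<open>j\<close> and \<open>j + 2\<close>; the second provides the
decay.
\<close>

lemma schwartz_moment_decay:
  assumes "f \<in> schwartz"
  shows "quadratic_decay (\<lambda>x. of_real (x ^ j) * (vderiv ^^ n) f x)"
proof (rule quadratic_decayI)
  fix x :: real
  let ?D = "(vderiv ^^ n) f x"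
  have "(1 + x\<^sup>2) * norm (of_real (x ^ j) * ?D) = norm (x ^ j *\<^sub>R ?D) + norm (x ^ (j + 2) *\<^sub>R ?D)"
    unfolding power_add norm_scaleR norm_mult norm_of_real abs_mult by (simp add: algebra_simps)
  also have "\<dots> \<le> schwartz_seminorm j n f + schwartz_seminorm (j + 2) n f"
    by (intro add_mono schwartz_seminorm_upper assms)
  finally show "norm (of_real (x ^ j) * ?D)
      \<le> (schwartz_seminorm j n f + schwartz_seminorm (j + 2) n f) * inverse (1 + x\<^sup>2)"
    by (simp add: field_simps add_pos_nonneg)
qed

definition chirp :: "real \<Rightarrow> real \<Rightarrow> real \<Rightarrow> complex" where
  "chirp \<alpha> \<beta> x = cis (pi * (\<alpha> * x\<^sup>2 + \<beta> * x))"

lemma chirp_has_vector_derivative: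
  "(chirp \<alpha> \<beta> has_vector_derivative chirp \<alpha> \<beta> x * (\<i> * of_real (pi * (2 * \<alpha> * x + \<beta>)))) (at x)"
proof -
  have "((\<lambda>z. exp (\<i> * of_real pi * (of_real \<alpha> * z\<^sup>2 + of_real \<beta> * z))) has_field_derivative
      exp (\<i> * of_real pi * (of_real \<alpha> * (of_real x)\<^sup>2 + of_real \<beta> * of_real x))
        * (\<i> * of_real pi * (of_real \<alpha> * (2 * of_real x) + of_real \<beta>))) (at (of_real x))"
    by (auto intro!: derivative_eq_intros)
  from has_vector_derivative_real_field[OF this] show ?thesis
    unfolding chirp_def cis_conv_exp by (simp add: mult_ac)
qed

text \<open>
With \<open>w\<close> the chirp and \<open>w' = w L\<close> for a linear \<open>L\<close>, the derivatives of \<open>w f\<close> are \<open>w\<close> times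
polynomial multiples of derivatives of \<open>f\<close>, at most quadratic in the polynomial factor. As \<open>w\<close> has
modulus one, the moments of \<open>f\<close> bound them.
\<close>

lemma c2_decay_chirp_schwartz:
  assumes f: "f \<in> schwartz"
  shows "\<exists>g' g''. c2_decay (\<lambda>x. chirp \<alpha> \<beta> x * f x) g' g''"
proof -
  let ?w = "chirp \<alpha> \<beta>"
  define L where "L = (\<lambda>x. \<i> * of_real (pi * (2 * \<alpha> * x + \<beta>)))"
  define D1 where "D1 = vderiv f"
  define D2 where "D2 = vderiv D1"
  define h where "h = (\<lambda>x. D1 x + L x * f x)"
  define h' where "h' = (\<lambda>x. D2 x + (L x * D1 x + \<i> * of_real (2 * pi * \<alpha>) * f x))"
  have w: "(?w has_vector_derivative ?w x * L x) (at x)" for x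
    unfolding L_def by (rule chirp_has_vector_derivative)
  have L: "(L has_vector_derivative \<i> * of_real (2 * pi * \<alpha>)) (at x)" for x
  proof -
    have "((\<lambda>z. \<i> * of_real pi * (2 * of_real \<alpha> * z + of_real \<beta>)) has_field_derivative
        \<i> * of_real (2 * pi * \<alpha>)) (at (of_real x))"
      by (auto intro!: derivative_eq_intros)
    from has_vector_derivative_real_field[OF this] show ?thesis unfolding L_def by (simp add: mult_ac)
  qed
  have d0: "(f has_vector_derivative D1 x) (at x)" and d1: "(D1 has_vector_derivative D2 x) (at x)" for x
    using schwartz_has_vector_derivative[OF f, of 0 x] schwartz_has_vector_derivative[OF f, of 1 x]
    by (simp_all add: D1_def D2_def)
  have h: "(h has_vector_derivative h' x) (at x)" for x
    unfolding h_def h'_def by (intro has_vector_derivative_add has_vector_derivative_mult d0 d1 L)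
  have moment0: "quadratic_decay (\<lambda>x. of_real (x ^ j) * f x)"
    and moment1: "quadratic_decay (\<lambda>x. of_real (x ^ j) * D1 x)"
    and moment2: "quadratic_decay (\<lambda>x. of_real (x ^ j) * D2 x)" for j
    using schwartz_moment_decay[OF f, of j 0] schwartz_moment_decay[OF f, of j 1] schwartz_moment_decay[OF f, of j 2]
    by (simp_all add: D1_def D2_def numeral_2_eq_2)
  have L_mult: "quadratic_decay (\<lambda>x. L x * u x)"
    if "quadratic_decay (\<lambda>x. of_real (x ^ 0) * u x)" "quadratic_decay (\<lambda>x. of_real (x ^ 1) * u x)" for u
  proof -
    have "quadratic_decay (\<lambda>x. \<i> * of_real (2 * pi * \<alpha>) * (of_real (x ^ 1) * u x)
        + \<i> * of_real (pi * \<beta>) * (of_real (x ^ 0) * u x))"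
      by (intro quadratic_decay_add quadratic_decay_cmult that)
    then show ?thesis unfolding L_def by (simp add: algebra_simps)
  qed
  have decay_f: "quadratic_decay f" and decay_D1: "quadratic_decay D1" and decay_D2: "quadratic_decay D2"
    using moment0[of 0] moment1[of 0] moment2[of 0] by simp_all
  have decay_Lf: "quadratic_decay (\<lambda>x. L x * f x)" by (rule L_mult[OF moment0 moment0])
  have decay_LD1: "quadratic_decay (\<lambda>x. L x * D1 x)" by (rule L_mult[OF moment1 moment1])
  have decay_LLf: "quadratic_decay (\<lambda>x. L x * (L x * f x))"
  proof (rule L_mult)
    show "quadratic_decay (\<lambda>x. of_real (x ^ 0) * (L x * f x))" using decay_Lf by simp
    have "quadratic_decay (\<lambda>x. L x * (of_real (x ^ 1) * f x))"
    proof (rule L_mult)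
      show "quadratic_decay (\<lambda>x. of_real (x ^ 0) * (of_real (x ^ 1) * f x))" using moment0[of 1] by simp
      show "quadratic_decay (\<lambda>x. of_real (x ^ 1) * (of_real (x ^ 1) * f x))"
        using moment0[of 2] by (simp add: power2_eq_square mult.assoc)
    qed
    then show "quadratic_decay (\<lambda>x. of_real (x ^ 1) * (L x * f x))" by (simp add: mult_ac)
  qed
  have decay_h: "quadratic_decay h"
    unfolding h_def by (intro quadratic_decay_add decay_D1 decay_Lf)
  have decay_h': "quadratic_decay h'"
    unfolding h'_def by (intro quadratic_decay_add quadratic_decay_cmult decay_D2 decay_LD1 decay_f)
  have decay_Lh: "quadratic_decay (\<lambda>x. L x * h x)"
    unfolding h_def distrib_left by (intro quadratic_decay_add decay_LD1 decay_LLf)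
  have w_mult: "quadratic_decay (\<lambda>x. ?w x * u x)" if "quadratic_decay u" for u
    by (rule quadratic_decay_mult_bounded[OF that, where B = 1]) (simp add: chirp_def)
  have "((\<lambda>x. ?w x * f x) has_vector_derivative ?w x * h x) (at x)" for x
  proof -
    have "((\<lambda>x. ?w x * f x) has_vector_derivative ?w x * D1 x + ?w x * L x * f x) (at x)"
      by (intro has_vector_derivative_mult w d0)
    then show ?thesis unfolding h_def by (simp add: algebra_simps)
  qed
  moreover have "((\<lambda>x. ?w x * h x) has_vector_derivative ?w x * (h' x + L x * h x)) (at x)" for x
  proof -
    have "((\<lambda>x. ?w x * h x) has_vector_derivative ?w x * h' x + ?w x * L x * h x) (at x)"
      by (intro has_vector_derivative_mult w h)
    then show ?thesis by (simp add: algebra_simps)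
  qed
  moreover have "continuous_on UNIV (\<lambda>x. ?w x * (h' x + L x * h x))"
  proof -
    have "continuous_on UNIV D2"
      using schwartz_has_vector_derivative[OF f, of 2]
      by (auto intro: continuous_on_vector_derivative simp: D1_def D2_def numeral_2_eq_2)
    moreover have "continuous_on UNIV D1" "continuous_on UNIV f" "continuous_on UNIV h"
      using d1 d0 h by (blast intro: continuous_on_vector_derivative)+
    moreover have "continuous_on UNIV L" "continuous_on UNIV ?w"
      using continuous_on_vector_derivative[OF has_vector_derivative_at_within[OF L]]
        continuous_on_vector_derivative[OF has_vector_derivative_at_within[OF w]] by blast+
    ultimately show ?thesis unfolding h'_def by (intro continuous_intros)
  qed
  ultimately have "c2_decay (\<lambda>x. ?w x * f x) (\<lambda>x. ?w x * h x) (\<lambda>x. ?w x * (h' x + L x * h x))"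
    unfolding c2_decay_def by (simp add: w_mult decay_f decay_h quadratic_decay_add decay_h' decay_Lh)
  then show ?thesis by blast
qed

lemma poisson_summation_chirp:
  assumes "f \<in> schwartz"
  shows "((\<lambda>k::int. LINT x|lborel. chirp \<alpha> \<beta> x * f x * cis (- (2 * pi * of_int k) * x))
           has_sum (\<Sum>\<^sub>\<infinity>n::int. chirp \<alpha> \<beta> (of_int n) * f (of_int n))) UNIV"
  using c2_decay_chirp_schwartz[OF assms] poisson_summation by blast

section \<open>Quadratic Gauss sums\<close>

text \<open>
A root of unity of order dividing \<open>2 b\<close>. Roots of order \<open>b\<close> would not suffice, as the exponents
\<open>a r\<^sup>2 + q r\<close> of the Gauss sums can be odd.
\<close>

definition root_phase :: "int \<Rightarrow> int \<Rightarrow> complex" where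
  "root_phase b m = cis (pi * of_int m / of_int b)"

lemma root_phase_add: "root_phase b (m + n) = root_phase b m * root_phase b n"
  by (simp add: root_phase_def cis_mult add_divide_distrib distrib_left)

lemma root_phase_nonzero [simp]: "root_phase b m \<noteq> 0"
  by (simp add: root_phase_def)

lemma root_phase_0 [simp]: "root_phase b 0 = 1"
  by (simp add: root_phase_def)

lemma root_phase_period:
  assumes "b \<noteq> 0" "m - n = 2 * b * l"
  shows "root_phase b m = root_phase b n"
proof -
  have "m = n + 2 * b * l" using assms(2) by simp
  moreover have "root_phase b (2 * b * l) = 1"
  proof -
    have "pi * of_int (2 * b * l) / of_int b = 2 * pi * of_int l" using assms(1) by simp
    then show ?thesis by (simp add: root_phase_def)
  qed
  ultimately show ?thesis by (simp add: root_phase_add)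
qed

lemma root_phase_eq_1D:
  assumes "b > 0" "root_phase b (2 * r) = 1"
  shows "b dvd r"
proof -
  have "exp (\<i> * of_real (pi * of_int (2 * r) / of_int b)) = 1"
    using assms(2) by (simp add: root_phase_def cis_conv_exp)
  then obtain l :: int where "pi * of_int (2 * r) / of_int b = of_int (2 * l) * pi"
    unfolding exp_eq_1 by auto
  then have "real_of_int r = of_int (l * b)" using assms(1) by (simp add: field_simps)
  then have "r = l * b" by (simp only: of_int_eq_iff)
  then show ?thesis by simp
qed

text \<open>
A function on the residue classes modulo \<open>b\<close> has the same sum after an invertible affine
substitution, which permutes the classes.
\<close>

lemma sum_periodic_affine:
  fixes h :: "int \<Rightarrow> 'a::comm_monoid_add"
  assumes b: "b > 0" and u: "coprime u b" and periodic: "\<And>x y. [x = y] (mod b) \<Longrightarrow> h x = h y"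
  shows "(\<Sum>r=0..b - 1. h (u * r + v)) = (\<Sum>r=0..b - 1. h r)"
proof -
  let ?t = "\<lambda>r. (u * r + v) mod b"
  have inj: "inj_on ?t {0..b - 1}"
  proof (rule inj_onI)
    fix r s assume rs: "r \<in> {0..b - 1}" "s \<in> {0..b - 1}" "?t r = ?t s"
    then have "[u * r + v = u * s + v] (mod b)" by (simp add: cong_def)
    then have "[r = s] (mod b)"
      using u by (simp add: cong_add_rcancel cong_mult_lcancel)
    then show "r = s" using rs(1,2) b by (simp add: cong_def)
  qed
  moreover have "?t ` {0..b - 1} \<subseteq> {0..b - 1}"
    using b by auto
  ultimately have "?t ` {0..b - 1} = {0..b - 1}"
    by (intro endo_inj_surj) auto
  then have "(\<Sum>r=0..b - 1. h r) = (\<Sum>r=0..b - 1. h (?t r))"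
    using sum.reindex[OF inj, of h] by (simp add: o_def)
  also have "\<dots> = (\<Sum>r=0..b - 1. h (u * r + v))"
    by (intro sum.cong refl periodic) (simp add: cong_def)
  finally show ?thesis ..
qed

context
  fixes a b c d q p :: int
  assumes b: "b > 0" and det: "a * d - b * c = 1"
    and q: "[q = a * b] (mod 2)" and p: "[p = c * d] (mod 2)"
begin

text \<open>
Replacing \<open>y\<close> by \<open>y + b k\<close> changes the exponent by \<open>2 b a y k + b k (a b k + q)\<close>. This is a
multiple of \<open>2 b\<close>, since \<open>k (a b k + q)\<close> has the parity of \<open>a b k (k + 1)\<close>.
\<close>

lemma gauss_term_periodic:
  assumes "[x = y] (mod b)"
  shows "root_phase b (a * x\<^sup>2 + q * x) = root_phase b (a * y\<^sup>2 + q * y)"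
proof -
  obtain k where k: "x = y + b * k" using assms by (metis cong_iff_lin add.commute cong_sym)
  have "even (a * b + q)" using cong_dvd_iff[OF q] by simp
  then have "even (k * (a * b * k + q))" by auto
  then obtain l where l: "k * (a * b * k + q) = 2 * l" by (elim evenE)
  have "(a * x\<^sup>2 + q * x) - (a * y\<^sup>2 + q * y) = 2 * b * (a * y * k) + b * (k * (a * b * k + q))"
    unfolding k by (simp add: algebra_simps power2_eq_square)
  also have "\<dots> = 2 * b * (a * y * k + l)" unfolding l by (simp add: algebra_simps)
  finally show ?thesis using b by (intro root_phase_period) auto
qed

text \<open>
Completing the square. Translating \<open>r\<close> by \<open>- d n\<close> in the Gauss sum and using \<open>ad = 1 + bc\<close>
produces the exponent on the left, up to a multiple of \<open>2 b\<close>: what is left over,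
\<open>b n (c d n - p)\<close>, is such a multiple because \<open>n (c d n - p)\<close> has the parity of \<open>p n (n - 1)\<close>.
\<close>

lemma gauss_sum_translate:
  "(\<Sum>r=0..b - 1. root_phase b (a * r\<^sup>2 + q * r) * root_phase b (d * n\<^sup>2 - d * q * n + b * p * n - 2 * r * n))
     = (\<Sum>r=0..b - 1. root_phase b (a * r\<^sup>2 + q * r))"
proof -
  have "(\<Sum>r=0..b - 1. root_phase b (a * r\<^sup>2 + q * r))
      = (\<Sum>r=0..b - 1. root_phase b (a * (1 * r + - d * n)\<^sup>2 + q * (1 * r + - d * n)))"
    by (rule sum_periodic_affine[symmetric, OF b _ gauss_term_periodic]) auto
  also have "\<dots> = (\<Sum>r=0..b - 1. root_phase b ((a * r\<^sup>2 + q * r) + (d * n\<^sup>2 - d * q * n + b * p * n - 2 * r * n)))"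
  proof (intro sum.cong refl)
    fix r
    have "even (n * (c * d * n - p))" using cong_dvd_iff[OF p] by auto
    then obtain l where l: "n * (c * d * n - p) = 2 * l" by (elim evenE)
    have ad: "a * d = 1 + b * c" using det by simp
    have "(a * (1 * r + - d * n)\<^sup>2 + q * (1 * r + - d * n)) - ((a * r\<^sup>2 + q * r) + (d * n\<^sup>2 - d * q * n + b * p * n - 2 * r * n))
        = 2 * r * n * (1 - a * d) + d * n\<^sup>2 * (a * d - 1) - b * p * n"
      by (simp add: algebra_simps power2_eq_square)
    also have "\<dots> = b * (n * (c * d * n - p)) - 2 * b * (c * r * n)"
      unfolding ad by (simp add: algebra_simps power2_eq_square)
    also have "\<dots> = 2 * b * (l - c * r * n)" unfolding l by (simp add: algebra_simps)
    finally show "root_phase b (a * (1 * r + - d * n)\<^sup>2 + q * (1 * r + - d * n))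
        = root_phase b ((a * r\<^sup>2 + q * r) + (d * n\<^sup>2 - d * q * n + b * p * n - 2 * r * n))"
      using b by (intro root_phase_period) auto
  qed
  finally show ?thesis unfolding root_phase_add ..
qed

text \<open>
The substitution \<open>r = - d n\<close>, a bijection modulo \<open>b\<close>, changes the leading coefficient from \<open>a\<close> to
\<open>a d\<^sup>2\<close>, which is \<open>d\<close> modulo \<open>b\<close>.
\<close>

lemma gauss_sum_reciprocal:
  "(\<Sum>n=0..b - 1. root_phase b (d * n\<^sup>2 - d * q * n + b * p * n)) = (\<Sum>r=0..b - 1. root_phase b (a * r\<^sup>2 + q * r))"
proof -
  have "coprime d b"
  proof (rule coprimeI)
    fix e assume "e dvd d" "e dvd b"
    then have "e dvd a * d - b * c" by (intro dvd_diff dvd_mult dvd_mult2)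
    then show "is_unit e" unfolding det .
  qed
  then have "coprime (- d) b" by simp
  then have "(\<Sum>r=0..b - 1. root_phase b (a * r\<^sup>2 + q * r))
      = (\<Sum>n=0..b - 1. root_phase b (a * (- d * n + 0)\<^sup>2 + q * (- d * n + 0)))"
    by (rule sum_periodic_affine[symmetric, OF b _ gauss_term_periodic])
  also have "\<dots> = (\<Sum>n=0..b - 1. root_phase b (d * n\<^sup>2 - d * q * n + b * p * n))"
  proof (intro sum.cong refl)
    fix n
    have "even (n * (c * d * n - p))" using cong_dvd_iff[OF p] by auto
    then obtain l where l: "n * (c * d * n - p) = 2 * l" by (elim evenE)
    have ad: "a * d = 1 + b * c" using det by simp
    have "(a * (- d * n + 0)\<^sup>2 + q * (- d * n + 0)) - (d * n\<^sup>2 - d * q * n + b * p * n) = d * n\<^sup>2 * (a * d - 1) - b * p * n"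
      by (simp add: algebra_simps power2_eq_square)
    also have "\<dots> = b * (n * (c * d * n - p))" unfolding ad by (simp add: algebra_simps power2_eq_square)
    finally have "(a * (- d * n + 0)\<^sup>2 + q * (- d * n + 0)) - (d * n\<^sup>2 - d * q * n + b * p * n) = 2 * b * l"
      unfolding l by simp
    then show "root_phase b (a * (- d * n + 0)\<^sup>2 + q * (- d * n + 0)) = root_phase b (d * n\<^sup>2 - d * q * n + b * p * n)"
      using b by (intro root_phase_period) auto
  qed
  finally show ?thesis ..
qed

text \<open>
If the sum vanished, then by \<open>gauss_sum_translate\<close> so would all coefficients of the discrete Fourier
transform of \<open>r \<mapsto> e(a r\<^sup>2 + q r)\<close>. But they add up to \<open>b\<close> times the value at \<open>r = 0\<close>, which is 1.
\<close>

lemma gauss_sum_nonzero: "(\<Sum>r=0..b - 1. root_phase b (a * r\<^sup>2 + q * r)) \<noteq> 0"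
proof
  assume zero: "(\<Sum>r=0..b - 1. root_phase b (a * r\<^sup>2 + q * r)) = 0"
  have transform: "(\<Sum>r=0..b - 1. root_phase b (a * r\<^sup>2 + q * r) * root_phase b (2 * (- r) * n)) = 0" for n
  proof -
    have "0 = (\<Sum>r=0..b - 1. root_phase b (a * r\<^sup>2 + q * r) * root_phase b ((d * n\<^sup>2 - d * q * n + b * p * n) + 2 * (- r) * n))"
      using gauss_sum_translate[of n] zero by simp
    also have "\<dots> = root_phase b (d * n\<^sup>2 - d * q * n + b * p * n)
        * (\<Sum>r=0..b - 1. root_phase b (a * r\<^sup>2 + q * r) * root_phase b (2 * (- r) * n))"
      unfolding root_phase_add[of _ "d * n\<^sup>2 - d * q * n + b * p * n"] sum_distrib_left by (simp add: mult_ac)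
    finally show ?thesis by simp
  qed
  have orthogonal: "(\<Sum>n=0..b - 1. root_phase b (2 * (- r) * n)) = (if r = 0 then of_int b else 0)" if r: "r \<in> {0..b - 1}" for r
  proof (cases "r = 0")
    case True
    then show ?thesis using b by simp
  next
    case False
    let ?S = "\<Sum>n=0..b - 1. root_phase b (2 * (- r) * n)"
    \<comment> \<open>Shifting the index multiplies the sum of a nontrivial character by a value other than 1.\<close>
    have "?S = (\<Sum>n=0..b - 1. root_phase b (2 * (- r) * (1 * n + 1)))"
    proof (rule sum_periodic_affine[symmetric, OF b])
      fix x y assume "[x = y] (mod b)"
      then obtain k where "x = y + b * k" by (metis cong_iff_lin add.commute cong_sym)
      then show "root_phase b (2 * (- r) * x) = root_phase b (2 * (- r) * y)"
        using b by (intro root_phase_period[of _ _ _ "- r * k"]) (auto simp: algebra_simps)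
    qed simp
    also have "\<dots> = root_phase b (2 * (- r)) * ?S"
      unfolding sum_distrib_left root_phase_add[symmetric] by (simp add: algebra_simps)
    finally have "?S = 0 \<or> root_phase b (2 * (- r)) = 1" by auto
    moreover have "\<not> b dvd - r" using r False zdvd_not_zless[of r b] by auto
    ultimately show ?thesis using root_phase_eq_1D[OF b, of "- r"] False by auto
  qed
  have "0 = (\<Sum>n=0..b - 1. \<Sum>r=0..b - 1. root_phase b (a * r\<^sup>2 + q * r) * root_phase b (2 * (- r) * n))"
    using transform by simp
  also have "\<dots> = (\<Sum>r=0..b - 1. root_phase b (a * r\<^sup>2 + q * r) * (\<Sum>n=0..b - 1. root_phase b (2 * (- r) * n)))"
    by (subst sum.swap) (simp add: sum_distrib_left)
  also have "\<dots> = (\<Sum>r=0..b - 1. root_phase b (a * r\<^sup>2 + q * r) * (if r = 0 then of_int b else 0))"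
    by (intro sum.cong refl arg_cong2[where f = "(*)"] orthogonal)
  also have "\<dots> = of_int b"
    using b by (simp add: if_distrib sum.delta cong: if_cong)
  finally show False using b by simp
qed

end

section \<open>A Schwartz function that the Dirac comb does not annihilate\<close>

text \<open>
Polynomial multiples of the Gaussian are closed under differentiation, so the iterated derivatives
of the Gaussian need not be computed.
\<close>

definition poly_gaussian :: "real poly \<Rightarrow> real \<Rightarrow> complex" where
  "poly_gaussian P x = of_real (poly P x * exp (- x\<^sup>2))"

lemma poly_gaussian_has_vector_derivative:
  "(poly_gaussian P has_vector_derivative poly_gaussian (pderiv P - [:0, 2:] * P) x) (at x)"
proof -
  have "((\<lambda>x. poly P x * exp (- x\<^sup>2)) has_field_derivative
      poly P x * (exp (- x\<^sup>2) * (- (2 * x))) + poly (pderiv P) x * exp (- x\<^sup>2)) (at x)"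
    by (auto intro!: derivative_eq_intros poly_DERIV)
  then have "((\<lambda>x. poly P x * exp (- x\<^sup>2)) has_field_derivative poly (pderiv P - [:0, 2:] * P) x * exp (- x\<^sup>2)) (at x)"
    by (simp add: algebra_simps)
  then show ?thesis
    unfolding poly_gaussian_def by (rule has_vector_derivative_of_real)
qed

text \<open>
As \<open>\<bar>x\<bar>\<^sup>k \<le> 1 + (x\<^sup>2)\<^sup>k\<close>, it suffices to compare \<open>(x\<^sup>2)\<^sup>k\<close> with the term of degree \<open>k\<close> in the
exponential series of \<open>x\<^sup>2\<close>.
\<close>

lemma power_times_gaussian_bounded: "\<bar>x ^ k * exp (- x\<^sup>2)\<bar> \<le> 1 + fact k" for x :: real
proof -
  have "\<bar>x ^ k\<bar> \<le> 1 + (x\<^sup>2) ^ k"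
  proof (cases "\<bar>x\<bar> \<le> 1")
    case True
    then have "\<bar>x ^ k\<bar> \<le> 1" by (simp add: power_abs power_le_one)
    moreover have "0 \<le> (x\<^sup>2) ^ k" by simp
    ultimately show ?thesis by linarith
  next
    case False
    then have "\<bar>x\<bar> ^ k \<le> \<bar>x\<bar> ^ (2 * k)" by (intro power_increasing) auto
    then show ?thesis by (simp add: power_abs power_mult)
  qed
  also have "\<dots> \<le> exp (x\<^sup>2) + fact k * exp (x\<^sup>2)"
  proof (rule add_mono)
    show "1 \<le> exp (x\<^sup>2)" by simp
    have "(x\<^sup>2) ^ k /\<^sub>R fact k \<le> (\<Sum>n. (x\<^sup>2) ^ n /\<^sub>R fact n)"
      using sum_le_suminf[OF summable_exp_generic[of "x\<^sup>2"], of "{k}"] by simp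
    then have "(x\<^sup>2) ^ k / fact k \<le> exp (x\<^sup>2)" unfolding exp_def by (simp add: divide_inverse mult.commute)
    then show "(x\<^sup>2) ^ k \<le> fact k * exp (x\<^sup>2)" by (simp add: field_simps)
  qed
  finally have "\<bar>x ^ k\<bar> * exp (- x\<^sup>2) \<le> (1 + fact k) * exp (x\<^sup>2) * exp (- x\<^sup>2)"
    by (intro mult_right_mono) (auto simp: distrib_right)
  also have "\<dots> = 1 + fact k" unfolding mult.assoc exp_minus_inverse by simp
  finally show ?thesis by (simp add: abs_mult)
qed

lemma poly_gaussian_schwartz: "poly_gaussian P \<in> schwartz"
proof -
  have iterate: "(vderiv ^^ n) (poly_gaussian P) = poly_gaussian (((\<lambda>P. pderiv P - [:0, 2:] * P) ^^ n) P)" for n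
  proof (induction n)
    case (Suc n)
    have "vderiv (poly_gaussian Q) = poly_gaussian (pderiv Q - [:0, 2:] * Q)" for Q
      unfolding vderiv_def by (intro ext vector_derivative_at poly_gaussian_has_vector_derivative)
    then show ?case unfolding funpow.simps o_apply Suc.IH .
  qed simp
  have bounded: "bounded (range (\<lambda>x. x ^ k *\<^sub>R poly_gaussian Q x))" for k Q
  proof -
    let ?B = "\<Sum>i\<le>degree Q. \<bar>coeff Q i\<bar> * (1 + fact (k + i))"
    have "norm (x ^ k *\<^sub>R poly_gaussian Q x) \<le> ?B" for x
    proof -
      have "norm (x ^ k *\<^sub>R poly_gaussian Q x) = \<bar>\<Sum>i\<le>degree Q. coeff Q i * (x ^ (k + i) * exp (- x\<^sup>2))\<bar>"
        unfolding poly_gaussian_def norm_scaleR norm_of_real abs_mult[symmetric]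
        by (simp add: poly_altdef sum_distrib_left sum_distrib_right power_add mult_ac)
      also have "\<dots> \<le> (\<Sum>i\<le>degree Q. \<bar>coeff Q i * (x ^ (k + i) * exp (- x\<^sup>2))\<bar>)"
        by (rule sum_abs)
      also have "\<dots> \<le> ?B"
        unfolding abs_mult[of "coeff Q _"]
        by (intro sum_mono mult_left_mono power_times_gaussian_bounded) simp
      finally show ?thesis .
    qed
    then show ?thesis by (auto simp: bounded_iff)
  qed
  show ?thesis
    unfolding schwartz_def mem_Collect_eq iterate
    using bounded poly_gaussian_has_vector_derivative differentiableI_vector by blast
qed

lemma dirac_comb_gaussian_nonzero: "dirac_comb (poly_gaussian 1) \<noteq> 0"
proof -
  have summable: "(\<lambda>k::int. exp (- (of_int k)\<^sup>2) :: real) summable_on UNIV"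
    using schwartz_abs_summable_int[OF poly_gaussian_schwartz[of 1]] by (simp add: poly_gaussian_def)
  have "(\<Sum>\<^sub>\<infinity>k\<in>{0::int}. exp (- (of_int k)\<^sup>2) :: real) \<le> (\<Sum>\<^sub>\<infinity>k::int. exp (- (of_int k)\<^sup>2))"
    by (rule infsum_mono_neutral) (use summable in auto)
  then have "(\<Sum>\<^sub>\<infinity>k::int. exp (- (of_int k)\<^sup>2) :: real) \<noteq> 0" by simp
  moreover have "dirac_comb (poly_gaussian 1) = of_real (\<Sum>\<^sub>\<infinity>k::int. exp (- (of_int k)\<^sup>2))"
    unfolding dirac_comb_def poly_gaussian_def poly_1 mult_1 by (rule infsumI[OF has_sum_of_real[OF has_sum_infsum[OF summable]]])
  ultimately show ?thesis by simp
qed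

section \<open>The eigenvalue of the Dirac comb\<close>

text \<open>
The substitution \<open>x = t - q/2\<close> undoes the translation in the phase-space shift, and all quadratic
phases combine. Writing \<open>k = b j + r\<close> separates the frequency \<open>k / b\<close> into the integer \<open>j\<close>, left as a
Fourier variable, and \<open>r / b\<close>, absorbed into the linear coefficient of the chirp.
\<close>

lemma metaplectic_transpose_phase_shift:
  fixes a b d q p k :: int
  assumes b: "b > 0" and k: "k = b * j + r"
    and M: "M $ 1 $ 1 = of_int a" "M $ 1 $ 2 = of_int b" "M $ 2 $ 2 = of_int d"
    and periodic: "root_phase b (a * k\<^sup>2 + q * k) = root_phase b (a * r\<^sup>2 + q * r)"
  shows "metaplectic_transpose M (phase_shift (- (of_int q / 2)) (of_int p / 2) \<phi>) (of_int k)
     = cis (pi * (of_int d * (of_int q)\<^sup>2 / (4 * of_int b) - of_int p * of_int q / 4)) / csqrt (\<i> * of_int b)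
        * root_phase b (a * r\<^sup>2 + q * r)
        * (LINT x|lborel. chirp (of_int d / of_int b) (of_int p - of_int (d * q + 2 * r) / of_int b) x * \<phi> x
             * cis (- (2 * pi * of_int j) * x))"
proof -
  let ?\<kappa> = "of_int d * (of_int q)\<^sup>2 / (4 * of_int b) - of_int p * of_int q / 4 :: real"
  let ?\<psi> = "phase_shift (- (of_int q / 2)) (of_int p / 2) \<phi>"
  let ?B = "of_int b :: real"
  have kernel: "metaplectic_kernel M x (of_int k) = 1 / csqrt (\<i> * of_int b) *
      cis (pi * ((of_int d * x\<^sup>2 - 2 * x * of_int k + of_int a * (of_int k)\<^sup>2) / ?B))" for x
    unfolding metaplectic_kernel_def Let_def M by (simp add: cis_conv_exp mult_ac)
  have shift: "?\<psi> x = cis (pi * (of_int q * of_int p / 4 + of_int p * x)) * \<phi> (x + of_int q / 2)" for x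
    unfolding phase_shift_def cis_conv_exp by (simp add: field_simps)
  have "metaplectic_kernel M (- (of_int q / 2) + 1 * t) (of_int k) * ?\<psi> (- (of_int q / 2) + 1 * t)
     = cis (pi * ?\<kappa>) / csqrt (\<i> * of_int b) * root_phase b (a * k\<^sup>2 + q * k)
       * (chirp (of_int d / ?B) (of_int p - of_int (d * q + 2 * r) / ?B) t * \<phi> t * cis (- (2 * pi * of_int j) * t))" for t
  proof -
    let ?x = "- (of_int q / 2) + 1 * t"
    have "pi * ((of_int d * ?x\<^sup>2 - 2 * ?x * of_int k + of_int a * (of_int k)\<^sup>2) / ?B) + pi * (of_int q * of_int p / 4 + of_int p * ?x)
        = pi * ?\<kappa> + (pi * of_int (a * k\<^sup>2 + q * k) / ?B
            + (pi * (of_int d / ?B * t\<^sup>2 + (of_int p - of_int (d * q + 2 * r) / ?B) * t) + - (2 * pi * of_int j) * t))"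
      using b unfolding k by (simp add: field_simps power2_eq_square)
    from arg_cong[OF this, of cis]
    have phases: "cis (pi * ((of_int d * ?x\<^sup>2 - 2 * ?x * of_int k + of_int a * (of_int k)\<^sup>2) / ?B)) * cis (pi * (of_int q * of_int p / 4 + of_int p * ?x))
        = cis (pi * ?\<kappa>) * (root_phase b (a * k\<^sup>2 + q * k)
            * (chirp (of_int d / ?B) (of_int p - of_int (d * q + 2 * r) / ?B) t * cis (- (2 * pi * of_int j) * t)))"
      unfolding cis_mult[symmetric] root_phase_def chirp_def .
    have arrange: "1 / s * u * (v * f) = K / s * R * (w * f * z)" if "u * v = K * (R * (w * z))" for s u v f K R w z :: complex
    proof -
      have "1 / s * u * (v * f) = u * v * f / s" by simp
      then show ?thesis unfolding that by simp
    qed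
    have "\<phi> (?x + of_int q / 2) = \<phi> t" by simp
    then show ?thesis unfolding kernel shift by (simp only: arrange[OF phases])
  qed
  moreover have "metaplectic_transpose M ?\<psi> (of_int k)
      = (LINT t|lborel. metaplectic_kernel M (- (of_int q / 2) + 1 * t) (of_int k) * ?\<psi> (- (of_int q / 2) + 1 * t))"
    unfolding metaplectic_transpose_def by (subst lborel_integral_real_affine[of 1 _ "- (of_int q / 2)"]) simp_all
  ultimately show ?thesis unfolding periodic by simp
qed

lemma inverse_csqrt_ii_times:
  assumes "x > 0"
  shows "1 / csqrt (\<i> * of_real x) = exp (- of_real pi * \<i> / 4) / of_real (sqrt x)"
proof -
  have "csqrt (\<i> * of_real x) = of_real (sqrt x) * cis (pi / 4)"
  proof (rule csqrt_unique)
    have half_eq: "pi / 4 + pi / 4 = pi / 2" by simp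
    have "(cis (pi / 4))\<^sup>2 = \<i>" unfolding power2_eq_square cis_mult by (simp only: half_eq cis_pi_half)
    moreover have "(complex_of_real (sqrt x))\<^sup>2 = of_real x"
      unfolding of_real_power[symmetric] using assms by simp
    ultimately show "(of_real (sqrt x) * cis (pi / 4))\<^sup>2 = \<i> * of_real x"
      unfolding power_mult_distrib by simp
    have "0 < Re (of_real (sqrt x) * cis (pi / 4))" using assms by (simp add: cos_45)
    then show "0 < Re (of_real (sqrt x) * cis (pi / 4)) \<or>
        Re (of_real (sqrt x) * cis (pi / 4)) = 0 \<and> 0 \<le> Im (of_real (sqrt x) * cis (pi / 4))" ..
  qed
  then have "1 / csqrt (\<i> * of_real x) = inverse (cis (pi / 4)) / of_real (sqrt x)"
    by (simp only: divide_inverse inverse_mult_distrib mult_1 mult.commute)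
  moreover have "\<i> * of_real (- (pi / 4)) = - of_real pi * \<i> / 4" by simp
  ultimately show ?thesis unfolding cis_inverse by (simp only: cis_conv_exp)
qed

lemma has_sum_finite_sum:
  fixes f :: "'i \<Rightarrow> 'a \<Rightarrow> complex"
  assumes "finite I" "\<And>i. i \<in> I \<Longrightarrow> (f i has_sum s i) A"
  shows "((\<lambda>x. \<Sum>i\<in>I. f i x) has_sum (\<Sum>i\<in>I. s i)) A"
  using assms by (induction I rule: finite_induct) (simp_all add: has_sum_add)

lemma has_sum_int_residues:
  fixes b :: int and f :: "int \<Rightarrow> complex"
  assumes b: "b > 0"
    and sums: "\<And>r. r \<in> {0..b - 1} \<Longrightarrow> ((\<lambda>j. f (b * j + r)) has_sum s r) UNIV"
  shows "(f has_sum (\<Sum>r=0..b - 1. s r)) UNIV"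
proof -
  let ?C = "\<lambda>r. range (\<lambda>j. b * j + r)"
  have "(f has_sum (\<Sum>r=0..b - 1. s r)) (\<Union> (?C ` {0..b - 1}))"
  proof (rule sum_has_sum)
    fix r assume r: "r \<in> {0..b - 1}"
    have "inj (\<lambda>j. b * j + r)" using b by (auto intro: injI)
    from has_sum_reindex[OF this, of f "s r"] show "(f has_sum s r) (?C r)"
      using sums[OF r] by (simp add: o_def)
  next
    fix r s assume "r \<in> {0..b - 1}" "s \<in> {0..b - 1}" "r \<noteq> s"
    moreover have "(b * j + t) mod b = t" if "t \<in> {0..b - 1}" for t j using that by simp
    ultimately have "b * j + r \<noteq> b * l + s" for j l by metis
    then show "?C r \<inter> ?C s = {}" by blast
  qed simp
  moreover have "k \<in> \<Union> (?C ` {0..b - 1})" for k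
  proof -
    have "k = b * (k div b) + k mod b" "k mod b \<in> {0..b - 1}" using b by auto
    then show ?thesis by blast
  qed
  ultimately show ?thesis by (metis UNIV_eq_I)
qed

text \<open>
Poisson summation on each residue class modulo \<open>b\<close>. The eigenvalue is left in terms of the Gauss sum
with leading coefficient \<open>a\<close>, for which nonvanishing is available.
\<close>

lemma comb_eigenvector:
  fixes a b c d q p :: int
  assumes b: "b > 0" and det: "a * d - b * c = 1"
    and q: "[q = a * b] (mod 2)" and p: "[p = c * d] (mod 2)"
    and M: "M $ 1 $ 1 = of_int a" "M $ 1 $ 2 = of_int b" "M $ 2 $ 2 = of_int d"
    and \<phi>: "\<phi> \<in> schwartz"
  shows "phase_shift_dist (of_int q / 2) (of_int p / 2) (metaplectic_dist M dirac_comb) \<phi>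
     = cis (pi * (of_int d * (of_int q)\<^sup>2 / (4 * of_int b) - of_int p * of_int q / 4)) / csqrt (\<i> * of_int b)
        * (\<Sum>r=0..b - 1. root_phase b (a * r\<^sup>2 + q * r)) * dirac_comb \<phi>"
    (is "_ = ?K * ?G * _")
proof -
  let ?\<psi> = "phase_shift (- (of_int q / 2)) (of_int p / 2) \<phi>"
  let ?T = "\<lambda>k::int. metaplectic_transpose M ?\<psi> (of_int k)"
  let ?\<beta> = "\<lambda>r. of_int p - of_int (d * q + 2 * r) / of_int b :: real"
  let ?w = "\<lambda>r n. chirp (of_int d / of_int b) (?\<beta> r) (of_int n)"
  have "(?T has_sum (\<Sum>r=0..b - 1. ?K * root_phase b (a * r\<^sup>2 + q * r) * (\<Sum>\<^sub>\<infinity>n::int. ?w r n * \<phi> (of_int n)))) UNIV"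
  proof (rule has_sum_int_residues[OF b])
    fix r
    have "root_phase b (a * (b * j + r)\<^sup>2 + q * (b * j + r)) = root_phase b (a * r\<^sup>2 + q * r)" for j
      by (rule gauss_term_periodic[OF b det q p]) (simp add: cong_def)
    note T = metaplectic_transpose_phase_shift[OF b refl M this, where p = p and \<phi> = \<phi>]
    show "((\<lambda>j. ?T (b * j + r)) has_sum ?K * root_phase b (a * r\<^sup>2 + q * r) * (\<Sum>\<^sub>\<infinity>n::int. ?w r n * \<phi> (of_int n))) UNIV"
      unfolding T by (intro has_sum_cmult_right poisson_summation_chirp \<phi>)
  qed
  then have "infsum ?T UNIV = (\<Sum>r=0..b - 1. ?K * root_phase b (a * r\<^sup>2 + q * r) * (\<Sum>\<^sub>\<infinity>n::int. ?w r n * \<phi> (of_int n)))"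
    by (rule infsumI)
  also have "\<dots> = (\<Sum>\<^sub>\<infinity>n::int. \<Sum>r=0..b - 1. ?K * root_phase b (a * r\<^sup>2 + q * r) * (?w r n * \<phi> (of_int n)))"
  proof (rule infsumI[symmetric], rule has_sum_finite_sum)
    fix r
    have "(\<lambda>n::int. ?w r n * \<phi> (of_int n)) summable_on UNIV"
      by (rule abs_summable_summable) (simp add: norm_mult chirp_def schwartz_abs_summable_int[OF \<phi>])
    then show "((\<lambda>n::int. ?K * root_phase b (a * r\<^sup>2 + q * r) * (?w r n * \<phi> (of_int n))) has_sum
        ?K * root_phase b (a * r\<^sup>2 + q * r) * (\<Sum>\<^sub>\<infinity>n::int. ?w r n * \<phi> (of_int n))) UNIV"
      by (intro has_sum_cmult_right has_sum_infsum)
  qed simp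
  also have "\<dots> = (\<Sum>\<^sub>\<infinity>n::int. ?K * ?G * \<phi> (of_int n))"
  proof (rule infsum_cong)
    fix n :: int
    have "?w r n = root_phase b (d * n\<^sup>2 - d * q * n + b * p * n - 2 * r * n)" for r
      unfolding chirp_def root_phase_def
      by (rule arg_cong[where f = cis]) (use b in \<open>simp add: field_simps power2_eq_square\<close>)
    then have "(\<Sum>r=0..b - 1. ?K * root_phase b (a * r\<^sup>2 + q * r) * (?w r n * \<phi> (of_int n)))
        = ?K * (\<Sum>r=0..b - 1. root_phase b (a * r\<^sup>2 + q * r) * root_phase b (d * n\<^sup>2 - d * q * n + b * p * n - 2 * r * n)) * \<phi> (of_int n)"
      by (simp only: sum_distrib_left sum_distrib_right mult.assoc)
    then show "(\<Sum>r=0..b - 1. ?K * root_phase b (a * r\<^sup>2 + q * r) * (?w r n * \<phi> (of_int n))) = ?K * ?G * \<phi> (of_int n)"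
      unfolding gauss_sum_translate[OF b det q p] .
  qed
  also have "\<dots> = ?K * ?G * dirac_comb \<phi>"
    unfolding dirac_comb_def by (rule infsum_cmult_right')
  finally show ?thesis
    unfolding phase_shift_dist_def metaplectic_dist_def dirac_comb_def[of "metaplectic_transpose _ _"] .
qed

theorem theorem7p5:
  fixes M :: "int^2^2" and a b c d q p :: int and E :: "int \<Rightarrow> real"
  assumes "M = vector [vector [a, b], vector [c, d]]"
    and "det M = 1"
    and "b > 0"
    and "[q = a * b] (mod 2)" and "[p = c * d] (mod 2)"
    and "\<And>n. E n = - of_int d / (2 * of_int b) * (of_int n - of_int q / 2)\<^sup>2
                    - 1 / 2 * of_int p * of_int n + 1 / 8 * of_int q * of_int p"
  shows "comb_eigenvalue M q p =
           exp (- of_real pi * \<i> / 4) / of_real (sqrt (of_int b)) *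
           (\<Sum>n = 0..b - 1. exp (- 2 * of_real pi * \<i> * of_real (E n)))"
proof -
  let ?\<kappa> = "of_int d * (of_int q)\<^sup>2 / (4 * of_int b) - of_int p * of_int q / 4 :: real"
  let ?G = "\<Sum>r=0..b - 1. root_phase b (a * r\<^sup>2 + q * r)"
  let ?\<mu> = "cis (pi * ?\<kappa>) / csqrt (\<i> * of_int b) * ?G"
  let ?A = "phase_shift_dist (of_int q / 2) (of_int p / 2) (metaplectic_dist (real_matrix M) dirac_comb)"
  note b = \<open>b > 0\<close> and q = \<open>[q = a * b] (mod 2)\<close> and p = \<open>[p = c * d] (mod 2)\<close>
  have det: "a * d - b * c = 1" using assms(1,2) by (simp add: det_2)
  have entries: "real_matrix M $ 1 $ 1 = of_int a" "real_matrix M $ 1 $ 2 = of_int b" "real_matrix M $ 2 $ 2 = of_int d"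
    unfolding assms(1) by (simp_all add: real_matrix_def)
  note eigenvector = comb_eigenvector[OF b det q p entries]
  have nonzero: "?\<mu> \<noteq> 0"
    using gauss_sum_nonzero[OF b det q p] b by simp
  have "comb_eigenvalue M q p = ?\<mu>"
    unfolding comb_eigenvalue_def
  proof (rule the_equality)
    show "?\<mu> \<noteq> 0 \<and> (\<forall>\<phi>\<in>schwartz. ?A \<phi> = ?\<mu> * dirac_comb \<phi>)"
      using nonzero eigenvector by blast
    fix \<nu> assume "\<nu> \<noteq> 0 \<and> (\<forall>\<phi>\<in>schwartz. ?A \<phi> = \<nu> * dirac_comb \<phi>)"
    then have "\<nu> * dirac_comb (poly_gaussian 1) = ?\<mu> * dirac_comb (poly_gaussian 1)"
      using eigenvector[OF poly_gaussian_schwartz[of 1]] poly_gaussian_schwartz[of 1] by metis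
    then show "\<nu> = ?\<mu>" by (rule mult_right_cancel[THEN iffD1, OF dirac_comb_gaussian_nonzero])
  qed
  also have "\<dots> = (1 / csqrt (\<i> * of_real (of_int b))) * (cis (pi * ?\<kappa>) * ?G)"
    by simp
  also have "cis (pi * ?\<kappa>) * ?G = (\<Sum>n = 0..b - 1. exp (- 2 * of_real pi * \<i> * of_real (E n)))"
    unfolding gauss_sum_reciprocal[OF b det q p, symmetric] sum_distrib_left
  proof (intro sum.cong refl)
    fix n
    have "pi * ?\<kappa> + pi * of_int (d * n\<^sup>2 - d * q * n + b * p * n) / of_int b = - 2 * pi * E n"
      unfolding assms(6) using b by (simp add: field_simps power2_eq_square)
    then show "cis (pi * ?\<kappa>) * root_phase b (d * n\<^sup>2 - d * q * n + b * p * n) = exp (- 2 * of_real pi * \<i> * of_real (E n))"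
      unfolding root_phase_def cis_mult by (simp add: cis_conv_exp mult_ac)
  qed
  also have "1 / csqrt (\<i> * of_real (of_int b)) = exp (- of_real pi * \<i> / 4) / of_real (sqrt (of_int b))"
    using b by (intro inverse_csqrt_ii_times) simp
  finally show ?thesis .
qed

end
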